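(* Let $f:\mathbb{R}/\mathbb{Z}\to\mathbb{Z}$ be a function of bounded variation with $\int_0^1 f(t)\,dt=0$. For irrational $\alpha\in(0,1)$ let $T_\alpha:\mathbb{R}/\mathbb{Z}\times\mathbb{Z}\to\mathbb{R}/\mathbb{Z}\times\mathbb{Z}$ be the skew product $T_\alpha(y,g)=(y+\alpha,\,g+f(y))$, which preserves the product $\mu$ of Lebesgue measure and counting measure. Suppose that for almost every $\alpha$ the skew product $T_\alpha$ is conservative and ergodic with respect to $\mu$. Then for almost every $\alpha$ the skew product $T_\alpha$ is $(1/n)$-recurrent.
   Context: "Almost every $\alpha$" is with respect to Lebesgue measure on $(0,1)$. For $\omega:\mathbb{R}^+\to\mathbb{R}^+$ nonincreasing and regularly varying ($\omega(kx)\asymp\omega(x)$ for every $k\in\mathbb{R}^+$), a set $A$ with $0<\mu(A)<\infty$ and a point $x$, put $\zeta(x)=\sum_i\chi_A(T^ix)\,\omega(i)$, summed over $i\ge0$ (over $i\ge1$ when, as for $\omega(n)=1/n$, $\omega(0)$ is not defined). When $T$ is conservative and ergodic, $\zeta$ is either finite almost everywhere or infinite almost everywhere, independently of the choice of $A$ of positive finite measure. The system is called $\omega$-recurrent if $\zeta(x)=\infty$ for $\mu$-almost every $x$; $(1/n)$-recurrent means $\omega$-recurrent for $\omega(n)=1/n$. *)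

theory Defs
  imports "HOL-Analysis.Analysis"
begin

definition conservative :: "'a measure \<Rightarrow> ('a \<Rightarrow> 'a) \<Rightarrow> bool" where
  "conservative M T \<longleftrightarrow>
     (\<forall>W\<in>sets M. disjoint_family (\<lambda>n::nat. (T ^^ n) -` W \<inter> space M) \<longrightarrow> emeasure M W = 0)"

definition ergodic :: "'a measure \<Rightarrow> ('a \<Rightarrow> 'a) \<Rightarrow> bool" where
  "ergodic M T \<longleftrightarrow>
     (\<forall>A\<in>sets M. T -` A \<inter> space M = A \<longrightarrow> emeasure M A = 0 \<or> emeasure M (space M - A) = 0)"

(* The sum runs over i \<ge> 0. A weight that is not defined at 0 is to be given the value 0 there,
   so that the sum starts at i = 1. For the weight 1 / x this is automatic, as 1 / 0 = 0;
   see weighted_visits_harmonic. *)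
definition weighted_visits :: "('a \<Rightarrow> 'a) \<Rightarrow> (real \<Rightarrow> real) \<Rightarrow> 'a set \<Rightarrow> 'a \<Rightarrow> ennreal" where
  "weighted_visits T \<omega> A x = (\<Sum>i. indicator A ((T ^^ i) x) * ennreal (\<omega> (real i)))"

lemma weighted_visits_harmonic:
  "weighted_visits T (\<lambda>x. 1 / x) A x =
     (\<Sum>i. indicator A ((T ^^ Suc i) x) * ennreal (1 / real (Suc i)))"
proof -
  have "weighted_visits T (\<lambda>x. 1 / x) A x =
      (\<Sum>i. indicator A ((T ^^ (i + 1)) x) * ennreal (1 / real (i + 1)))
      + (\<Sum>i<1. indicator A ((T ^^ i) x) * ennreal (1 / real i))"
    unfolding weighted_visits_def by (rule suminf_offset) simp
  then show ?thesis by simp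
qed

(* All sets A are required to have divergent sums. If T is conservative and ergodic, then one A
   suffices. *)
definition omega_recurrent :: "'a measure \<Rightarrow> ('a \<Rightarrow> 'a) \<Rightarrow> (real \<Rightarrow> real) \<Rightarrow> bool" where
  "omega_recurrent M T \<omega> \<longleftrightarrow>
     (\<forall>A\<in>sets M. 0 < emeasure M A \<and> emeasure M A < \<infinity> \<longrightarrow>
        (AE x in M. weighted_visits T \<omega> A x = \<infinity>))"

definition bounded_variation_on :: "real set \<Rightarrow> (real \<Rightarrow> real) \<Rightarrow> bool" where
  "bounded_variation_on S f \<longleftrightarrow>
     (\<exists>B. \<forall>(n::nat) t. mono_on {..n} t \<and> t ` {..n} \<subseteq> S \<longrightarrow>
        (\<Sum>i<n. \<bar>f (t (Suc i)) - f (t i)\<bar>) \<le> B)"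

(* Points of the circle R/Z are represented by their representatives in [0,1), and functions on
   the circle by functions on the reals of period 1. *)
definition circle_measure :: "real measure" where
  "circle_measure = restrict_space lborel {0..<1}"

definition skew_measure :: "(real \<times> int) measure" where
  "skew_measure = circle_measure \<Otimes>\<^sub>M count_space UNIV"

definition skew_product :: "(real \<Rightarrow> int) \<Rightarrow> real \<Rightarrow> real \<times> int \<Rightarrow> real \<times> int" where
  "skew_product f \<alpha> = (\<lambda>(y, g). (frac (y + \<alpha>), g + f y))"

end

theory Submission
  imports Defs
begin

text \<open>
  Fix \<open>\<alpha>\<close> with ergodic skew product and a set \<open>A\<close> of positive measure. Suppose that the harmonic sum of the visits to
  \<open>A\<close> were bounded on a part of \<open>A\<close> of positive measure. That part may be taken to be \<open>E \<times> {v}\<close>, and then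
  \<open>\<Sum>d. b d / d\<close> would be finite, where \<open>b d\<close> is the measure of the points of \<open>E\<close> that return to \<open>E\<close>
  after \<open>d\<close> steps at the same level (\<open>return_measure_sum_le\<close>). So it suffices to see that this series
  diverges for almost every \<open>\<alpha>\<close> and all \<open>E\<close> of positive measure; then the harmonic sum is infinite almost everywhere on \<open>A\<close>, and
  since its divergence is an invariant property, ergodicity spreads it to almost every point
  (\<open>omega_recurrent_if_returns_not_summable\<close>).

  The divergence is a pigeonhole argument. If the Birkhoff sums \<open>S k\<close> of \<open>f\<close> with \<open>k < N\<close> are at most \<open>R\<close>
  in absolute value, the visits to \<open>E\<close> before time \<open>N\<close> are spread over at most \<open>2 * R + 1\<close> levels, so that
  coincidences of levels force \<open>\<Sum>d<N. b d\<close> to be at least a constant times \<open>N / (2 * R + 1)\<close>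
  (\<open>return_measure_lower_bound\<close>). With \<open>R = R n\<close> for \<open>N = 2 ^ n\<close>, summation over dyadic scales gives
  \<open>\<Sum>d. b d / d = \<infinity>\<close> as soon as \<open>\<Sum>n. 1 / (2 * R n + 1) = \<infinity>\<close> (\<open>dyadic_averages_not_summable\<close>).

  The Birkhoff sums are controlled by Diophantine approximation at dyadic scales, in place of
  continued fractions. Dirichlet's theorem gives \<open>Q j \<le> 2 ^ j\<close> such that \<open>Q j * \<alpha>\<close> is within \<open>1 / 2 ^ j\<close> of
  an integer prime to \<open>Q j\<close>. The Denjoy--Koksma inequality (\<open>denjoy_koksma\<close>) bounds the Birkhoff sums of
  length \<open>Q j\<close> by a constant, and division with remainder yields \<open>R n = O(\<Sum>j<n. 2 ^ j / Q j)\<close>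
  (\<open>rotation_sum_dyadic_bound\<close>).

  It remains that \<open>\<Sum>n. 1 / (1 + (\<Sum>j<n. 2 ^ j / Q j))\<close> diverges for almost every \<open>\<alpha>\<close>
  (\<open>AE_dyadic_denominators\<close>). For given \<open>m\<close> the numbers \<open>\<alpha>\<close> for which \<open>m * \<alpha>\<close> is within \<open>\<epsilon>\<close> of an
  integer have measure at most \<open>4 * \<epsilon>\<close>. Hence almost surely \<open>2 ^ j / Q j \<le> (j+1)\<^sup>2\<close> for all large \<open>j\<close>,
  and the ratio truncated at that height has mean of order \<open>ln j\<close>. So the inner sums have, after truncation,
  means of order \<open>n * ln n\<close>, and since \<open>\<Sum>n. 1 / (n * ln n)\<close> diverges, so does the series in question
  almost surely (\<open>inverse_series_diverges\<close>).
\<close>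

section \<open>Birkhoff sums over rotations\<close>

definition rotation_sum :: "(real \<Rightarrow> 'b::comm_monoid_add) \<Rightarrow> real \<Rightarrow> nat \<Rightarrow> real \<Rightarrow> 'b" where
  "rotation_sum f \<alpha> k y = (\<Sum>i<k. f (y + real i * \<alpha>))"

lemma periodic_int:
  fixes f :: "real \<Rightarrow> 'b"
  assumes "\<And>x. f (x + c) = f x"
  shows "f (x + of_int m * c) = f x"
proof -
  have nat: "f (x + real n * c) = f x" for x n
  proof (induction n)
    case (Suc n)
    have "f (x + real (Suc n) * c) = f ((x + real n * c) + c)" by (simp add: algebra_simps)
    then show ?case using Suc assms by metis
  qed simp
  show ?thesis
  proof (cases "0 \<le> m")
    case True
    then show ?thesis using nat[of x "nat m"] by simp
  next
    case False
    then have "(x + of_int m * c) + real (nat (- m)) * c = x" by (simp add: algebra_simps)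
    then show ?thesis using nat[of "x + of_int m * c" "nat (- m)"] by metis
  qed
qed

lemma periodic_frac:
  fixes f :: "real \<Rightarrow> 'b"
  assumes "\<And>x. f (x + 1) = f x"
  shows "f (frac x) = f x"
  using periodic_int[of f 1 "frac x" "\<lfloor>x\<rfloor>"] assms by (simp add: frac_def)

lemma rotation_sum_periodic:
  assumes "\<And>x. f (x + 1) = f x"
  shows "rotation_sum f \<alpha> k (y + 1) = rotation_sum f \<alpha> k y"
proof -
  have "f (y + 1 + real i * \<alpha>) = f (y + real i * \<alpha>)" for i
    using assms[of "y + real i * \<alpha>"] by (simp add: algebra_simps)
  then show ?thesis unfolding rotation_sum_def by simp
qed

lemma rotation_sum_add:
  "rotation_sum f \<alpha> (m + k) y = rotation_sum f \<alpha> m y + rotation_sum f \<alpha> k (y + real m * \<alpha>)"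
proof (induction k)
  case (Suc k)
  have "rotation_sum f \<alpha> (m + Suc k) y = rotation_sum f \<alpha> (m + k) y + f (y + real (m + k) * \<alpha>)"
    by (simp add: rotation_sum_def add.commute)
  also have "real (m + k) * \<alpha> = real m * \<alpha> + real k * \<alpha>" by (simp add: algebra_simps)
  finally show ?case using Suc by (simp add: rotation_sum_def add_ac)
qed (simp add: rotation_sum_def)

section \<open>The circle and its rotations\<close>

lemma space_circle [simp]: "space circle_measure = {0..<1}"
  by (simp add: circle_measure_def space_restrict_space)

lemma sets_circle: "sets circle_measure = {A. A \<in> sets borel \<and> A \<subseteq> {0..<1}}"
  by (rule set_eqI) (simp add: circle_measure_def sets_restrict_space_iff conj_commute)

lemma emeasure_circle: "A \<subseteq> {0..<1} \<Longrightarrow> emeasure circle_measure A = emeasure lborel A"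
  by (simp add: circle_measure_def emeasure_restrict_space)

lemma measurable_circle_iff: "f \<in> measurable circle_measure M \<longleftrightarrow> f \<in> measurable (restrict_space borel {0..<1}) M"
  by (simp add: circle_measure_def cong: measurable_cong_sets) (metis measurable_cong_sets sets_lborel sets_restrict_space_cong)

lemma borel_measurable_circle: "f \<in> measurable borel M \<Longrightarrow> f \<in> measurable circle_measure M"
  unfolding measurable_circle_iff by (rule measurable_restrict_space1)

interpretation circle: finite_measure circle_measure
  by (rule finite_measureI) (simp add: emeasure_circle)

lemma measure_circle_space [simp]: "measure circle_measure {0..<1} = 1" "emeasure circle_measure {0..<1} = 1"
  by (simp_all add: measure_def emeasure_circle)

lemma frac_borel [measurable]: "(frac :: real \<Rightarrow> real) \<in> borel_measurable borel"
  unfolding frac_def by measurable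

lemma rotation_measurable [measurable]:
  "(\<lambda>y. frac (y + s)) \<in> measurable circle_measure circle_measure"
proof -
  have "(\<lambda>y. frac (y + s)) \<in> measurable circle_measure (restrict_space borel {0..<1})"
    by (rule measurable_restrict_space2) (auto intro!: borel_measurable_circle frac_lt_1)
  then show ?thesis
    by (subst measurable_cong_sets[OF refl, of _ "restrict_space borel {0..<1}"])
       (auto simp: circle_measure_def sets_restrict_space)
qed

text \<open>
  Wrapping around splits \<open>[0,1)\<close> into two intervals, on each of which the rotation is a translation
  of the line; so invariance is inherited from Lebesgue measure.
\<close>

lemma distr_rotation: "distr circle_measure circle_measure (\<lambda>y. frac (y + s)) = circle_measure"
proof (rule measure_eqI)
  fix A assume "A \<in> sets (distr circle_measure circle_measure (\<lambda>y. frac (y + s)))"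
  then have A: "A \<in> sets circle_measure" by simp
  then have Ab [measurable]: "A \<in> sets borel" and A01: "A \<subseteq> {0..<1}" by (auto simp: sets_circle)
  define r where "r = frac s"
  have r: "0 \<le> r" "r < 1" by (auto simp: r_def frac_lt_1)
  have fr: "frac (y + s) = (if y + r < 1 then y + r else y + r - 1)" if "y \<in> {0..<1}" for y
  proof -
    have "frac y = y" using that by (simp add: frac_eq)
    then show ?thesis using frac_add[of y s] by (simp add: r_def)
  qed
  have shift: "emeasure lborel {y. y + c \<in> D} = emeasure lborel D" if [measurable]: "D \<in> sets borel" for D and c :: real
  proof -
    have "emeasure lborel D = (\<integral>\<^sup>+x. indicator D x \<partial>lborel)" by simp
    also have "\<dots> = (\<integral>\<^sup>+x. indicator D (c + 1 * x) \<partial>lborel)"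
      by (subst nn_integral_real_affine[where c=1 and t=c]) auto
    also have "\<dots> = (\<integral>\<^sup>+x. indicator {y. y + c \<in> D} x \<partial>lborel)"
      by (intro nn_integral_cong) (auto simp: indicator_def add.commute)
    also have "\<dots> = emeasure lborel {y. y + c \<in> D}" by (rule nn_integral_indicator) measurable
    finally show ?thesis by simp
  qed
  have "(\<lambda>y. frac (y + s)) -` A \<inter> {0..<1} = {y. y + r \<in> A \<inter> {r..<1}} \<union> {y. y + (r - 1) \<in> A \<inter> {0..<r}}"
  proof (rule set_eqI)
    fix y
    show "y \<in> (\<lambda>y. frac (y + s)) -` A \<inter> {0..<1}
        \<longleftrightarrow> y \<in> {y. y + r \<in> A \<inter> {r..<1}} \<union> {y. y + (r - 1) \<in> A \<inter> {0..<r}}"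
    proof (cases "y \<in> {0..<1}")
      case True
      then show ?thesis using r fr[OF True] by (simp add: algebra_simps)
    next
      case False
      then show ?thesis using r by auto
    qed
  qed
  then have "emeasure circle_measure ((\<lambda>y. frac (y + s)) -` A \<inter> {0..<1})
      = emeasure lborel ({y. y + r \<in> A \<inter> {r..<1}} \<union> {y. y + (r - 1) \<in> A \<inter> {0..<r}})"
    using r by (subst emeasure_circle) auto
  also have "\<dots> = emeasure lborel {y. y + r \<in> A \<inter> {r..<1}} + emeasure lborel {y. y + (r - 1) \<in> A \<inter> {0..<r}}"
    by (intro plus_emeasure[symmetric]) auto
  also have "\<dots> = emeasure lborel (A \<inter> {r..<1}) + emeasure lborel (A \<inter> {0..<r})"
    by (intro arg_cong2[where f="(+)"] shift) auto
  also have "\<dots> = emeasure lborel (A \<inter> {r..<1} \<union> A \<inter> {0..<r})"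
    by (intro plus_emeasure) auto
  also have "A \<inter> {r..<1} \<union> A \<inter> {0..<r} = A" using A01 r by auto
  finally show "emeasure (distr circle_measure circle_measure (\<lambda>y. frac (y + s))) A = emeasure circle_measure A"
    using A A01 by (subst emeasure_distr) (auto simp: emeasure_circle)
qed simp

lemma integral_rotation:
  fixes g :: "real \<Rightarrow> real"
  assumes per: "\<And>x. g (x + 1) = g x" and [measurable]: "g \<in> borel_measurable borel"
  shows "(\<integral>y. g (y + s) \<partial>circle_measure) = (\<integral>y. g y \<partial>circle_measure)"
proof -
  have [measurable]: "g \<in> borel_measurable circle_measure" by (intro borel_measurable_circle) simp
  have "(\<integral>y. g y \<partial>circle_measure) = (\<integral>y. g y \<partial>distr circle_measure circle_measure (\<lambda>y. frac (y + s)))"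
    by (simp add: distr_rotation)
  also have "\<dots> = (\<integral>y. g (frac (y + s)) \<partial>circle_measure)" by (rule integral_distr) measurable
  finally show ?thesis by (simp add: periodic_frac[of g, OF per])
qed

section \<open>Functions of bounded variation on the circle\<close>

text \<open>
  The condition of \<open>bounded_variation_on\<close> with its bound made explicit: the bound on the Birkhoff
  sums depends on it.
\<close>

abbreviation variation_bound :: "real set \<Rightarrow> (real \<Rightarrow> real) \<Rightarrow> real \<Rightarrow> bool" where
  "variation_bound S f B \<equiv> (\<forall>(n::nat) t. mono_on {..n} t \<and> t ` {..n} \<subseteq> S \<longrightarrow>
        (\<Sum>i<n. \<bar>f (t (Suc i)) - f (t i)\<bar>) \<le> B)"

text \<open>
  With \<open>v x\<close> the total variation of \<open>f\<close> on \<open>[0,x]\<close>, both \<open>v\<close> and \<open>v - f\<close> are monotone on \<open>[0,1]\<close>,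
  hence Borel, and \<open>f\<close> is their difference.
\<close>

lemma bounded_variation_borel:
  assumes B: "variation_bound {0..1} f B" and per: "\<And>x. f (x + 1) = f x"
  shows "f \<in> borel_measurable borel"
proof -
  define vs where "vs x = {(\<Sum>i<n. \<bar>f (t (Suc i)) - f (t i)\<bar>) | n t. mono_on {..n} t \<and> t ` {..n} \<subseteq> {0..x}}"
    for x
  define v where "v x = Sup (vs x)" for x
  have bdd: "bdd_above (vs x)" if "x \<le> 1" for x
    using B that unfolding vs_def by (intro bdd_aboveI[of _ B]) (fastforce simp: subset_iff)
  have ne: "vs x \<noteq> {}" if "0 \<le> x" for x
  proof -
    have "(\<Sum>i<(0::nat). \<bar>f ((\<lambda>_. 0) (Suc i)) - f ((\<lambda>_. 0) i)\<bar>) \<in> vs x"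
      unfolding vs_def using that by (intro CollectI exI conjI refl) (auto simp: mono_on_def)
    then show ?thesis by blast
  qed
  have step: "v x + \<bar>f y - f x\<bar> \<le> v y" if xy: "0 \<le> x" "x \<le> y" "y \<le> 1" for x y
  proof -
    have "s \<le> v y - \<bar>f y - f x\<bar>" if "s \<in> vs x" for s
    proof -
      from that obtain n t where s: "s = (\<Sum>i<n. \<bar>f (t (Suc i)) - f (t i)\<bar>)"
        and t: "mono_on {..n} t" "t ` {..n} \<subseteq> {0..x}" unfolding vs_def by blast
      define u where "u i = (if i \<le> n then t i else if i = Suc n then x else y)" for i
      have tb: "0 \<le> t i \<and> t i \<le> x" if "i \<le> n" for i
        using t(2) that by (auto simp: image_subset_iff)
      have tm: "t i \<le> t j" if "i \<le> j" "j \<le> n" for i j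
        using mono_onD[OF t(1)] that by simp
      have "mono_on {..Suc (Suc n)} u"
      proof (rule mono_onI)
        fix i j :: nat assume "i \<le> j" "j \<in> {..Suc (Suc n)}"
        then show "u i \<le> u j" using tb[of i] tm[of i j] xy by (auto simp: u_def)
      qed
      moreover have "u ` {..Suc (Suc n)} \<subseteq> {0..y}"
      proof safe
        fix i assume "i \<le> Suc (Suc n)"
        then show "u i \<in> {0..y}" using tb[of i] xy by (auto simp: u_def)
      qed
      ultimately have "(\<Sum>i<Suc (Suc n). \<bar>f (u (Suc i)) - f (u i)\<bar>) \<in> vs y"
        unfolding vs_def by blast
      then have "(\<Sum>i<Suc (Suc n). \<bar>f (u (Suc i)) - f (u i)\<bar>) \<le> v y"
        unfolding v_def using bdd xy by (intro cSup_upper) auto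
      moreover have "(\<Sum>i<n. \<bar>f (u (Suc i)) - f (u i)\<bar>) = s"
        unfolding s by (intro sum.cong) (auto simp: u_def)
      ultimately show ?thesis by (simp add: u_def)
    qed
    then have "v x \<le> v y - \<bar>f y - f x\<bar>" unfolding v_def[of x] using ne xy by (intro cSup_least) auto
    then show ?thesis by simp
  qed
  have "mono_on {0..1} v" using step by (force simp: mono_on_def)
  moreover have "mono_on {0..1} (\<lambda>x. v x - f x)" using step by (force simp: mono_on_def)
  ultimately have "(\<lambda>x. v x - (v x - f x)) \<in> borel_measurable (restrict_space borel {0..1})"
    by (intro borel_measurable_diff borel_measurable_mono_on_fnc)
  then have "f \<in> borel_measurable (restrict_space borel {0..1})" by simp
  moreover have "(frac :: real \<Rightarrow> real) \<in> measurable borel (restrict_space borel {0..1})"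
    by (rule measurable_restrict_space2) (auto intro: less_imp_le[OF frac_lt_1])
  ultimately have "f \<circ> frac \<in> borel_measurable borel" by (rule measurable_comp[rotated])
  also have "f \<circ> frac = f" by (auto simp: periodic_frac[of f, OF per])
  finally show ?thesis .
qed

lemma bounded_variation_bounded:
  assumes B: "variation_bound {0..1} f B" and per: "\<And>x. f (x + 1) = f x"
  shows "\<bar>f x\<bar> \<le> \<bar>f 0\<bar> + B"
proof -
  define t where "t i = (if i = 0 then 0 else frac x)" for i :: nat
  have "mono_on {..1} t" by (auto simp: mono_on_def t_def)
  moreover have "t ` {..1} \<subseteq> {0..1}" by (auto simp: t_def less_imp_le[OF frac_lt_1])
  ultimately have "(\<Sum>i<1. \<bar>f (t (Suc i)) - f (t i)\<bar>) \<le> B" using B by blast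
  then have "\<bar>f (frac x) - f 0\<bar> \<le> B" by (simp add: t_def)
  then show ?thesis by (simp add: periodic_frac[of f, OF per])
qed

text \<open>
  A window of length \<open>1\<close> meets at most two consecutive periods, and each of them contributes at most
  \<open>B\<close>. Clamping a monotone sequence at the common end point of the two periods gives one monotone
  sequence inside each.
\<close>

lemma variation_bound_translate:
  assumes B: "variation_bound {0..1} f B" and per: "\<And>x. f (x + 1) = f x"
  shows "variation_bound {w..w + 1} f (2 * B)"
proof (intro allI impI, elim conjE)
  fix n :: nat and t
  assume mono: "mono_on {..n} t" and sub: "t ` {..n} \<subseteq> {w..w + 1}"
  define a b where "a i = min (t i - \<lfloor>w\<rfloor>) 1" and "b i = max (t i - \<lfloor>w\<rfloor>) 1 - 1" for i
  have rng: "t i - \<lfloor>w\<rfloor> \<in> {0..2}" if "i \<le> n" for i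
  proof -
    have "w \<le> t i" "t i \<le> w + 1" using sub that by (auto simp: image_subset_iff)
    then show ?thesis using floor_correct[of w] by (simp, linarith)
  qed
  \<comment> \<open>One of \<open>a i\<close>, \<open>b i\<close> always stands for the point where the two periods meet; there \<open>f\<close> is \<open>f 0\<close>.\<close>
  have fsplit: "f (t i) = f (a i) + f (b i) - f 0" for i
  proof -
    have "f (t i - \<lfloor>w\<rfloor>) = f (t i)" using periodic_int[of f 1 "t i" "-\<lfloor>w\<rfloor>"] per by simp
    moreover have "f (t i - \<lfloor>w\<rfloor> - 1) = f (t i - \<lfloor>w\<rfloor>)" using per[of "t i - \<lfloor>w\<rfloor> - 1"] by simp
    moreover have "f 1 = f 0" using per[of 0] by simp
    ultimately show ?thesis by (auto simp: a_def b_def min_def max_def)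
  qed
  have "a i \<le> a j" "b i \<le> b j" if "i \<le> j" "j \<le> n" for i j
    using mono_onD[OF mono, of i j] that by (auto simp: a_def b_def)
  then have "mono_on {..n} a" "mono_on {..n} b" by (auto intro!: mono_onI)
  moreover have "a ` {..n} \<subseteq> {0..1}" "b ` {..n} \<subseteq> {0..1}"
    using rng unfolding a_def b_def by (auto simp: image_subset_iff)
  ultimately have "(\<Sum>i<n. \<bar>f (a (Suc i)) - f (a i)\<bar>) \<le> B" "(\<Sum>i<n. \<bar>f (b (Suc i)) - f (b i)\<bar>) \<le> B"
    using B by blast+
  moreover have "(\<Sum>i<n. \<bar>f (t (Suc i)) - f (t i)\<bar>)
      \<le> (\<Sum>i<n. \<bar>f (a (Suc i)) - f (a i)\<bar> + \<bar>f (b (Suc i)) - f (b i)\<bar>)"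
    by (intro sum_mono) (simp add: fsplit)
  ultimately show "(\<Sum>i<n. \<bar>f (t (Suc i)) - f (t i)\<bar>) \<le> 2 * B" by (simp add: sum.distrib)
qed

text \<open>
  If \<open>x i\<close> and \<open>z i\<close> lie in the \<open>i\<close>-th of \<open>Q\<close> consecutive arcs, then the points sorted within each arc
  form one monotone sequence, whose variation dominates the sum of the differences.
\<close>

lemma variation_bound_pairs:
  assumes B: "variation_bound {w..w + 1} f B" and Q: "0 < Q"
    and x: "\<And>i. i < Q \<Longrightarrow> x i \<in> {w + real i / real Q .. w + real (Suc i) / real Q}"
    and z: "\<And>i. i < Q \<Longrightarrow> z i \<in> {w + real i / real Q .. w + real (Suc i) / real Q}"
  shows "(\<Sum>i<Q. \<bar>f (x i) - f (z i)\<bar>) \<le> B"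
proof -
  define u where "u j = (if even j then min (x (j div 2)) (z (j div 2)) else max (x (j div 2)) (z (j div 2)))" for j
  have u: "u j \<in> {w + real (j div 2) / real Q .. w + real (Suc (j div 2)) / real Q}" if "j < 2 * Q" for j
  proof -
    have "j div 2 < Q" using that by auto
    then show ?thesis using x[of "j div 2"] z[of "j div 2"] by (auto simp: u_def min_def max_def)
  qed
  have mono: "u i \<le> u j" if ij: "i \<le> j" "j < 2 * Q" for i j
  proof (cases "i div 2 = j div 2")
    case True
    then have "i = j \<or> even i \<and> odd j" using ij by presburger
    then consider "i = j" | "even i" "odd j" by blast
    then show ?thesis using True by cases (auto simp: u_def)
  next
    case False
    then have "Suc (i div 2) \<le> j div 2" using ij by (metis div_le_mono le_antisym not_less_eq_eq)
    then have "real (Suc (i div 2)) / real Q \<le> real (j div 2) / real Q"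
      using Q by (intro divide_right_mono) (auto simp del: of_nat_Suc)
    then show ?thesis using u[of i] u[of j] ij by (auto simp del: of_nat_Suc)
  qed
  have "mono_on {..2 * Q - 1} u" using Q by (auto simp: mono_on_def intro!: mono)
  moreover have "u ` {..2 * Q - 1} \<subseteq> {w..w + 1}"
  proof safe
    fix j assume "j \<le> 2 * Q - 1"
    then have j: "j < 2 * Q" using Q by auto
    then have "j div 2 < Q" by auto
    then have "real (Suc (j div 2)) / real Q \<le> 1" using Q by simp
    moreover have "0 \<le> real (j div 2) / real Q" by simp
    ultimately show "u j \<in> {w..w + 1}" using u[OF j] unfolding atLeastAtMost_iff by linarith
  qed
  ultimately have "(\<Sum>j<2 * Q - 1. \<bar>f (u (Suc j)) - f (u j)\<bar>) \<le> B" using B by blast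
  moreover have "(\<Sum>i<Q. \<bar>f (x i) - f (z i)\<bar>) \<le> (\<Sum>j<2 * Q - 1. \<bar>f (u (Suc j)) - f (u j)\<bar>)"
  proof -
    have "(\<Sum>i<Q. \<bar>f (x i) - f (z i)\<bar>) = (\<Sum>i<Q. \<bar>f (u (Suc (2 * i))) - f (u (2 * i))\<bar>)"
      by (intro sum.cong) (auto simp: u_def min_def max_def)
    also have "\<dots> = (\<Sum>j\<in>(\<lambda>i. 2 * i) ` {..<Q}. \<bar>f (u (Suc j)) - f (u j)\<bar>)"
      by (subst sum.reindex) (auto simp: inj_on_def)
    also have "\<dots> \<le> (\<Sum>j<2 * Q - 1. \<bar>f (u (Suc j)) - f (u j)\<bar>)"
      by (intro sum_mono2) auto
    finally show ?thesis .
  qed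
  ultimately show ?thesis by linarith
qed

section \<open>The Denjoy--Koksma inequality\<close>

text \<open>
  The sum of \<open>f\<close> over a translated grid of mesh \<open>1/Q\<close> is a function of the translation with period
  \<open>1/Q\<close> and mean zero, so it cannot be positive on a whole period.
\<close>

lemma grid_average_changes_sign:
  fixes f :: "real \<Rightarrow> real"
  assumes per: "\<And>x. f (x + 1) = f x" and [measurable]: "f \<in> borel_measurable borel"
    and bd: "\<And>x. \<bar>f x\<bar> \<le> C"
    and zero: "(\<integral>y. f y \<partial>circle_measure) = 0" and Q: "0 < Q"
  shows "\<exists>t\<in>{0..1 / real Q}. (\<Sum>i<Q. f (w + real i / real Q + t)) \<le> 0"
proof (rule ccontr)
  define G where "G t = (\<Sum>i<Q. f (t + (w + real i / real Q)))" for t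
  assume "\<not> ?thesis"
  then have pos: "G t > 0" if "t \<in> {0..1 / real Q}" for t using that by (force simp: G_def add_ac)
  have perG: "G (t + 1 / real Q) = G t" for t
  proof -
    have "G (t + 1 / real Q) = (\<Sum>i<Q. f (t + (w + real (Suc i) / real Q)))"
      unfolding G_def by (intro sum.cong) (auto simp: add_divide_distrib algebra_simps)
    also have "\<dots> = (\<Sum>i<Suc Q. f (t + (w + real i / real Q))) - f (t + w)"
      by (subst sum.lessThan_Suc_shift) simp
    also have "\<dots> = G t" using per[of "t + w"] Q by (simp add: G_def add_ac)
    finally show ?thesis .
  qed
  have posG: "G t > 0" for t
  proof -
    have "G t = G (frac (t * Q) / Q + of_int \<lfloor>t * Q\<rfloor> * (1 / real Q))"
      using Q by (simp add: frac_def diff_divide_distrib)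
    also have "\<dots> = G (frac (t * Q) / Q)" by (rule periodic_int[of G, OF perG])
    also have "\<dots> > 0" using Q by (intro pos) (auto simp: divide_right_mono less_imp_le[OF frac_lt_1])
    finally show ?thesis .
  qed
  have int: "integrable circle_measure (\<lambda>t. f (t + s))" for s
    by (rule circle.integrable_const_bound[where B=C]) (auto simp: bd intro!: borel_measurable_circle)
  have "(\<integral>t. G t \<partial>circle_measure) = 0"
    unfolding G_def using int zero
    by (subst Bochner_Integration.integral_sum) (auto simp: integral_rotation[of f, OF per])
  moreover have "integrable circle_measure G" unfolding G_def using int by auto
  ultimately have "AE t in circle_measure. G t = 0"
    using posG by (subst (asm) integral_nonneg_eq_0_iff_AE) (auto intro: less_imp_le)
  then obtain N where "{t \<in> space circle_measure. G t \<noteq> 0} \<subseteq> N" "emeasure circle_measure N = 0" "N \<in> sets circle_measure"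
    by (rule AE_E) auto
  moreover have "G t \<noteq> 0" for t using posG[of t] by simp
  ultimately have "emeasure circle_measure {0..<1} \<le> 0" using emeasure_mono[of "{0..<1}" N circle_measure] by (simp add: subset_iff)
  then show False by simp
qed

text \<open>
  As \<open>\<alpha>\<close> is within \<open>1/Q\<^sup>2\<close> of \<open>p/Q\<close>, the first \<open>Q\<close> points of the orbit of \<open>y\<close> are the grid
  \<open>y + \<int>/Q\<close> with every point displaced by at most \<open>1/Q\<close>, always in the same direction. Hence they can be
  matched with the \<open>Q\<close> consecutive arcs of length \<open>1/Q\<close> of a suitable partition of a period. Replacing
  them by the points of a translated grid changes the sum of \<open>f\<close> by at most the variation over that
  period, and there are translated grids with sums of either sign.
\<close>

theorem denjoy_koksma:
  fixes f :: "real \<Rightarrow> real"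
  assumes B: "variation_bound {0..1} f B" and per: "\<And>x. f (x + 1) = f x"
    and zero: "(\<integral>y. f y \<partial>circle_measure) = 0"
    and Q: "0 < Q" and cop: "coprime p (int Q)" and close: "\<bar>real Q * \<alpha> - of_int p\<bar> \<le> 1 / real Q"
  shows "\<bar>rotation_sum f \<alpha> Q y\<bar> \<le> 2 * B"
proof -
  define \<theta> where "\<theta> = \<alpha> - of_int p / real Q"
  \<comment> \<open>The displacement \<open>k * \<theta>\<close> has the sign of \<open>\<theta>\<close>, so the first arc starts at \<open>y\<close> or ends there.\<close>
  define w where "w = (if \<theta> \<ge> 0 then y else y - 1 / real Q)"
  \<comment> \<open>\<open>r k\<close> is the position on the grid \<open>y + \<int>/Q\<close> of the point of the orbit at time \<open>k\<close>.\<close>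
  define r where "r k = nat ((int k * p) mod int Q)" for k
  have "inj_on r {..<Q}"
  proof
    fix k l assume kl: "k \<in> {..<Q}" "l \<in> {..<Q}" and "r k = r l"
    moreover have "int (r j) = (int j * p) mod int Q" for j using Q by (simp add: r_def)
    ultimately have "(int k * p) mod int Q = (int l * p) mod int Q" by metis
    then have "int Q dvd (int k - int l) * p" by (simp add: mod_eq_dvd_iff left_diff_distrib)
    then have "int Q dvd int k - int l"
      using cop by (simp add: coprime_dvd_mult_left_iff coprime_commute)
    then show "k = l" using kl by (simp add: mod_eq_dvd_iff[symmetric])
  qed
  moreover have "r ` {..<Q} \<subseteq> {..<Q}" using Q by (auto simp: r_def nat_less_iff)
  ultimately have bij: "bij_betw r {..<Q} {..<Q}" by (simp add: endo_inj_surj bij_betw_def)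
  define \<sigma> where "\<sigma> = inv_into {..<Q} r"
  have \<sigma>: "\<sigma> i < Q" if "i < Q" for i
    using bij_betw_inv_into[OF bij] that by (auto simp: \<sigma>_def bij_betw_def)
  have \<theta>: "real Q * \<bar>\<theta>\<bar> \<le> 1 / real Q"
  proof -
    have "real Q * \<bar>\<theta>\<bar> = \<bar>real Q * \<theta>\<bar>" by (simp add: abs_mult)
    also have "real Q * \<theta> = real Q * \<alpha> - of_int p" using Q by (simp add: \<theta>_def algebra_simps)
    finally show ?thesis using close by simp
  qed
  define x where "x i = y + real (\<sigma> i) * \<theta> + real i / real Q" for i
  have fx: "f (y + real k * \<alpha>) = f (x (r k))" if "k < Q" for k
  proof -
    have "int k * p = int Q * ((int k * p) div int Q) + int (r k)" using Q by (simp add: r_def)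
    then have "real_of_int (int k * p) = of_int (int Q * ((int k * p) div int Q) + int (r k))" by presburger
    then have kp: "real k * of_int p / real Q = of_int ((int k * p) div int Q) + real (r k) / real Q"
      using Q by (simp add: field_simps)
    have "\<sigma> (r k) = k" using bij that by (simp add: \<sigma>_def bij_betw_def)
    then have "y + real k * \<alpha> = x (r k) + of_int ((int k * p) div int Q) * 1"
      using kp by (simp add: x_def \<theta>_def algebra_simps)
    then show ?thesis using periodic_int[of f 1] per by metis
  qed
  have "rotation_sum f \<alpha> Q y = (\<Sum>k<Q. f (x (r k)))" unfolding rotation_sum_def by (intro sum.cong) (auto simp: fx)
  also have "\<dots> = (\<Sum>i<Q. f (x i))" by (rule sum.reindex_bij_betw[OF bij])
  finally have S: "rotation_sum f \<alpha> Q y = (\<Sum>i<Q. f (x i))" .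
  have xi: "x i \<in> {w + real i / real Q .. w + real (Suc i) / real Q}" if "i < Q" for i
  proof -
    have "real (\<sigma> i) * \<bar>\<theta>\<bar> \<le> real Q * \<bar>\<theta>\<bar>" using \<sigma>[OF that] by (intro mult_right_mono) auto
    then have "real (\<sigma> i) * \<bar>\<theta>\<bar> \<le> 1 / real Q" using \<theta> by linarith
    moreover have "0 \<le> real (\<sigma> i) * \<bar>\<theta>\<bar>" by simp
    ultimately show ?thesis
      by (cases "\<theta> \<ge> 0") (simp_all add: x_def w_def add_divide_distrib)
  qed
  have meas: "f \<in> borel_measurable borel" using bounded_variation_borel[OF B per] .
  have bd: "\<bar>f x\<bar> \<le> \<bar>f 0\<bar> + B" for x using bounded_variation_bounded[OF B per] .
  have compare: "(\<Sum>i<Q. \<bar>f (x i) - f (w + real i / real Q + t)\<bar>) \<le> 2 * B" if "t \<in> {0..1 / real Q}" for t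
    using variation_bound_pairs[OF variation_bound_translate[OF B per, of w] Q xi, of "\<lambda>i. w + real i / real Q + t"] that
    by (auto simp: add_divide_distrib)
  obtain t where t: "t \<in> {0..1 / real Q}" "(\<Sum>i<Q. f (w + real i / real Q + t)) \<le> 0"
    using grid_average_changes_sign[of f, OF per meas bd zero Q] by blast
  obtain t' where t': "t' \<in> {0..1 / real Q}" "(\<Sum>i<Q. - f (w + real i / real Q + t')) \<le> 0"
    using grid_average_changes_sign[of "\<lambda>x. - f x" "\<bar>f 0\<bar> + B" Q w] per meas bd zero Q by auto
  have "(\<Sum>i<Q. f (x i)) \<le> (\<Sum>i<Q. f (w + real i / real Q + t)) + (\<Sum>i<Q. \<bar>f (x i) - f (w + real i / real Q + t)\<bar>)"
    by (subst sum.distrib[symmetric]) (intro sum_mono, linarith)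
  moreover have "- (\<Sum>i<Q. f (x i)) \<le> (\<Sum>i<Q. - f (w + real i / real Q + t')) + (\<Sum>i<Q. \<bar>f (x i) - f (w + real i / real Q + t')\<bar>)"
    by (subst sum.distrib[symmetric], subst sum_negf[symmetric]) (intro sum_mono, linarith)
  ultimately show ?thesis unfolding S using compare[OF t(1)] compare[OF t'(1)] t(2) t'(2) by linarith
qed

section \<open>Birkhoff sums at dyadic scales\<close>

lemma rotation_sum_mult_bound:
  fixes f :: "real \<Rightarrow> real"
  assumes "\<And>y. \<bar>rotation_sum f \<alpha> Q y\<bar> \<le> C"
  shows "\<bar>rotation_sum f \<alpha> (b * Q) y\<bar> \<le> real b * C"
proof (induction b)
  case (Suc b)
  have "rotation_sum f \<alpha> (Suc b * Q) y = rotation_sum f \<alpha> (b * Q) y + rotation_sum f \<alpha> Q (y + real (b * Q) * \<alpha>)"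
    using rotation_sum_add[of f \<alpha> "b * Q" Q y] by (simp add: add.commute)
  then have "\<bar>rotation_sum f \<alpha> (Suc b * Q) y\<bar> \<le> real b * C + C"
    using Suc assms[of "y + real (b * Q) * \<alpha>"] by linarith
  then show ?case by (simp add: algebra_simps)
qed (simp add: rotation_sum_def)

text \<open>
  This replaces the expansion of \<open>r\<close> in the denominators of the continued fraction of \<open>\<alpha>\<close>: dividing
  \<open>r < 2 ^ (n+1)\<close> by \<open>Q n\<close> leaves a remainder below \<open>2 ^ n\<close> and a quotient at most \<open>2 * 2 ^ n / Q n\<close>,
  and each of the blocks of length \<open>Q n\<close> costs \<open>C\<close>.
\<close>

lemma rotation_sum_dyadic_bound:
  fixes f :: "real \<Rightarrow> real"
  assumes Q: "\<And>j. 0 < Q j" "\<And>j. Q j \<le> 2 ^ j"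
    and C: "\<And>j y. \<bar>rotation_sum f \<alpha> (Q j) y\<bar> \<le> C"
    and r: "r < 2 ^ n"
  shows "\<bar>rotation_sum f \<alpha> r y\<bar> \<le> 2 * C * (\<Sum>j<n. 2 ^ j / real (Q j))"
  using r
proof (induction n arbitrary: r y)
  case 0
  then show ?case by (simp add: rotation_sum_def)
next
  case (Suc n)
  define b where "b = r div Q n"
  have C0: "0 \<le> C" using C[of 0 0] by linarith
  have r: "r = b * Q n + r mod Q n" by (simp add: b_def)
  have "r mod Q n < 2 ^ n" using Q(1)[of n] Q(2)[of n] using mod_less_divisor[of "Q n" r] by linarith
  note IH = Suc.IH[OF this, of "y + real (b * Q n) * \<alpha>"]
  have "real (b * Q n) \<le> 2 * 2 ^ n"
  proof -
    have "b * Q n \<le> 2 * 2 ^ n" using Suc.prems r by simp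
    then have "real (b * Q n) \<le> real (2 * 2 ^ n)" by (rule of_nat_mono)
    then show ?thesis by simp
  qed
  then have "real b \<le> 2 * (2 ^ n / real (Q n))" using Q(1)[of n] by (simp add: field_simps)
  then have b: "real b * C \<le> 2 * (2 ^ n / real (Q n)) * C" using C0 by (rule mult_right_mono)
  have "rotation_sum f \<alpha> r y = rotation_sum f \<alpha> (b * Q n) y + rotation_sum f \<alpha> (r mod Q n) (y + real (b * Q n) * \<alpha>)"
    using rotation_sum_add[of f \<alpha> "b * Q n" "r mod Q n" y] by (simp only: r[symmetric])
  then have "\<bar>rotation_sum f \<alpha> r y\<bar> \<le> real b * C + 2 * C * (\<Sum>j<n. 2 ^ j / real (Q j))"
    using IH rotation_sum_mult_bound[of f \<alpha> "Q n" C b y, OF C] by linarith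
  also have "\<dots> \<le> 2 * C * (\<Sum>j<Suc n. 2 ^ j / real (Q j))" using b by (simp add: algebra_simps)
  finally show ?case .
qed

lemma dyadic_denominators_exist:
  "\<exists>Q::nat \<Rightarrow> nat. \<forall>j. 0 < Q j \<and> Q j \<le> 2 ^ j \<and>
     (\<exists>p. coprime p (int (Q j)) \<and> \<bar>real (Q j) * \<alpha> - of_int p\<bar> \<le> 1 / 2 ^ j)"
proof (rule choice, rule allI)
  fix j :: nat
  obtain p k where pk: "coprime p k" "0 < k" "k \<le> int (2 ^ j)" "\<bar>of_int k * \<alpha> - of_int p\<bar> < 1 / real (2 ^ j)"
    by (rule Dirichlet_approx_coprime[of "2 ^ j" \<alpha>]) auto
  then show "\<exists>Q. 0 < Q \<and> Q \<le> 2 ^ j \<and> (\<exists>p. coprime p (int Q) \<and> \<bar>real Q * \<alpha> - of_int p\<bar> \<le> 1 / 2 ^ j)"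
    by (intro exI[of _ "nat k"]) (auto simp: nat_le_iff)
qed

section \<open>Dyadic denominators of almost every number\<close>

lemma sum_inverse_le_ln:
  assumes S: "\<And>m. m \<in> S \<Longrightarrow> 0 < m \<and> m \<le> b \<and> real b \<le> c * real m" and c: "1 \<le> c"
  shows "(\<Sum>m\<in>S. 1 / real m) \<le> 1 + ln c"
proof (cases "S = {}")
  case True
  then show ?thesis using c by simp
next
  case False
  have "S \<subseteq> {..b}" using S by auto
  then have fin: "finite S" by (rule finite_subset) simp
  define a where "a = Min S"
  have a: "a \<in> S" using fin False by (simp add: a_def)
  then have ab: "0 < a" "a \<le> b" "real b \<le> c * real a" using S by auto
  have le: "(\<Sum>m\<in>{a..n}. 1 / real m) \<le> 1 / real a + (ln (real n) - ln (real a))" if "a \<le> n" for n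
    using that
  proof (induction n rule: dec_induct)
    case (step n)
    have n: "0 < n" using step ab by auto
    have "ln (real n / real (Suc n)) \<le> real n / real (Suc n) - 1"
      using n by (intro ln_le_minus_one) auto
    also have "\<dots> = - (1 / real (Suc n))" by (simp add: field_simps)
    finally have "1 / real (Suc n) \<le> ln (real (Suc n)) - ln (real n)" using n by (simp add: ln_div)
    then show ?case using step by (simp add: sum.nat_ivl_Suc' del: of_nat_Suc)
  qed simp
  have "S \<subseteq> {a..b}" using S fin by (auto simp: a_def)
  then have "(\<Sum>m\<in>S. 1 / real m) \<le> (\<Sum>m\<in>{a..b}. 1 / real m)" by (intro sum_mono2) auto
  also have "\<dots> \<le> 1 / real a + ln (real b / real a)" using le[OF ab(2)] ab by (simp add: ln_div)
  also have "\<dots> \<le> 1 + ln c"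
    using ab c by (intro add_mono) (auto simp: field_simps)
  finally show ?thesis .
qed

lemma not_summable_n_ln_n:
  "\<not> summable (\<lambda>n. 1 / (real (n + 2) * ln (real (n + 2))))"
proof
  define f where "f n = 1 / (real (n + 1) * ln (real (n + 1)))" for n
  assume "summable (\<lambda>n. 1 / (real (n + 2) * ln (real (n + 2))))"
  then have "summable (\<lambda>n. f (Suc n))" by (simp add: f_def numeral_2_eq_2)
  then have "summable f" by (simp only: summable_Suc_iff)
  moreover have "summable f \<longleftrightarrow> summable (\<lambda>n. 2^n * f (2^n))"
  proof (rule condensation_test)
    show "f (Suc m) \<le> f m" if "0 < m" for m
      unfolding f_def using that by (intro divide_left_mono mult_mono mult_pos_pos) auto
    show "0 \<le> f n" for n by (simp add: f_def)
  qed
  ultimately have s: "summable (\<lambda>n. 2^n * f (2^n))" by simp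
  have "1 / 2 * inverse (real (Suc n)) \<le> 2^n * f (2^n)" for n
  proof -
    have "ln (2 ^ n + 1) \<le> ln (2 ^ Suc n :: real)" by (intro ln_mono) (auto intro: add_pos_pos)
    also have "\<dots> = real (Suc n) * ln 2" by (subst ln_realpow) auto
    also have "\<dots> \<le> real (Suc n) * 1" using ln_2_less_1 by (intro mult_left_mono) auto
    finally have l: "ln (2 ^ n + 1 :: real) \<le> real (Suc n)" by simp
    have "(2 ^ n + 1) * ln (2 ^ n + 1) \<le> (2 * 2 ^ n) * real (Suc n)"
      using l by (intro mult_mono) auto
    moreover have "0 < (2 ^ n + 1) * ln (2 ^ n + 1 :: real)"
      by (intro mult_pos_pos ln_gt_zero) (auto intro: add_pos_pos)
    ultimately have "2 ^ n / ((2 * 2 ^ n) * real (Suc n)) \<le> 2 ^ n / ((2 ^ n + 1) * ln (2 ^ n + 1 :: real))"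
      by (intro divide_left_mono) auto
    moreover have "2 ^ n / ((2 * 2 ^ n) * real (Suc n)) = 1 / 2 * inverse (real (Suc n))"
      by (simp add: divide_simps del: of_nat_Suc)
    moreover have e: "2 ^ n * f (2 ^ n) = 2 ^ n / ((2 ^ n + 1) * ln (2 ^ n + 1 :: real))"
      by (simp add: f_def add.commute)
    ultimately show ?thesis unfolding e by linarith
  qed
  then have "summable (\<lambda>n. 1 / 2 * inverse (real (Suc n)))"
    by (intro summable_comparison_test'[OF s, of 0]) auto
  then have "summable (\<lambda>n. inverse (real (Suc n)))" by (subst (asm) summable_cmult_iff) auto
  then have "summable (\<lambda>n. inverse (real n))" by (subst (asm) summable_Suc_iff)
  then show False using not_summable_harmonic[where 'a=real] by simp
qed

text \<open>
  A sequence of positive functions whose means grow slowly cannot grow fast on a set of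
  positive measure. On the set \<open>G s\<close> where the partial sums of \<open>1 / D n\<close> stay below \<open>s\<close>,
  the inequality \<open>1 / D \<ge> 2 * t - t\<^sup>2 * D\<close> with \<open>t\<close> proportional to \<open>w n\<close> turns the upper bounds for
  the means of \<open>D n\<close> into a lower bound proportional to the partial sums of \<open>w\<close>, which are unbounded.
\<close>

lemma (in finite_measure) inverse_series_diverges:
  fixes D :: "nat \<Rightarrow> 'a \<Rightarrow> real" and w :: "nat \<Rightarrow> real"
  assumes meas [measurable]: "\<And>n. D n \<in> borel_measurable M"
    and pos: "\<And>n x. 0 < D n x" and int: "\<And>n. integrable M (D n)"
    and mean: "\<And>n. (\<integral>x. D n x \<partial>M) \<le> c / w n"
    and w: "\<And>n. 0 < w n" "\<not> summable w" and c: "0 < c"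
  shows "AE x in M. \<not> summable (\<lambda>n. 1 / D n x)"
proof -
  define G where "G s = {x \<in> space M. \<forall>N. (\<Sum>n<N. 1 / D n x) \<le> real s}" for s :: nat
  have G [measurable]: "G s \<in> sets M" for s unfolding G_def by measurable
  have "measure M (G s) = 0" for s
  proof (rule ccontr)
    assume "measure M (G s) \<noteq> 0"
    define g where "g = measure M (G s)"
    have g: "0 < g" using \<open>measure M (G s) \<noteq> 0\<close> by (simp add: g_def zero_less_measure_iff)
    \<comment> \<open>The factor \<open>g / c\<close> maximises the quadratic lower bound.\<close>
    define t where "t n = g / c * w n" for n
    have "(\<Sum>n<N. w n) \<le> real s * c / g" for N
    proof -
      have le: "(\<Sum>n<N. 2 * t n * indicator (G s) x - (t n)\<^sup>2 * D n x) \<le> real s * indicator (G s) x" for x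
      proof (cases "x \<in> G s")
        case True
        have "2 * t n - (t n)\<^sup>2 * D n x \<le> 1 / D n x" for n
        proof -
          have "0 \<le> (1 - t n * D n x)\<^sup>2 / D n x" using pos[of n x] by simp
          also have "\<dots> = 1 / D n x - (2 * t n - (t n)\<^sup>2 * D n x)"
            using pos[of n x] by (simp add: field_simps power2_eq_square)
          finally show ?thesis by simp
        qed
        then have "(\<Sum>n<N. 2 * t n - (t n)\<^sup>2 * D n x) \<le> (\<Sum>n<N. 1 / D n x)" by (intro sum_mono)
        also have "\<dots> \<le> real s" using True by (simp add: G_def)
        finally show ?thesis using True by simp
      next
        case False
        have "0 \<le> (t n)\<^sup>2 * D n x" for n using pos[of n x] by simp
        then show ?thesis using False by (simp add: sum_nonneg sum_negf)
      qed
      have ind: "integrable M (indicator (G s) :: 'a \<Rightarrow> real)"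
        by (simp add: emeasure_eq_measure)
      have "(\<Sum>n<N. g\<^sup>2 / c * w n) \<le> (\<Sum>n<N. 2 * t n * g - (t n)\<^sup>2 * (\<integral>x. D n x \<partial>M))"
      proof (rule sum_mono)
        fix n
        have "(t n)\<^sup>2 * (\<integral>x. D n x \<partial>M) \<le> (t n)\<^sup>2 * (c / w n)" using mean by (intro mult_left_mono) auto
        also have "\<dots> = g\<^sup>2 / c * w n" using c w(1)[of n] by (simp add: t_def power2_eq_square)
        also have "\<dots> = 2 * t n * g - g\<^sup>2 / c * w n" by (simp add: t_def power2_eq_square field_simps)
        finally show "g\<^sup>2 / c * w n \<le> 2 * t n * g - (t n)\<^sup>2 * (\<integral>x. D n x \<partial>M)" by simp
      qed
      also have "\<dots> = (\<integral>x. (\<Sum>n<N. 2 * t n * indicator (G s) x - (t n)\<^sup>2 * D n x) \<partial>M)"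
        using int ind by (subst Bochner_Integration.integral_sum) (auto simp: g_def Bochner_Integration.integral_diff)
      also have "\<dots> \<le> (\<integral>x. real s * indicator (G s) x \<partial>M)"
        using int ind by (intro integral_mono le Bochner_Integration.integrable_sum
            Bochner_Integration.integrable_diff integrable_mult_right)
      also have "\<dots> = real s * g" by (simp add: g_def)
      finally have "g\<^sup>2 / c * (\<Sum>n<N. w n) \<le> real s * g" by (simp add: sum_distrib_left)
      then show ?thesis using g c by (simp add: field_simps power2_eq_square)
    qed
    then have "summable w" using w(1) by (intro summableI_nonneg_bounded) (auto intro: less_imp_le)
    then show False using w(2) by simp
  qed
  then have "AE x in M. \<forall>s. x \<notin> G s"
    by (subst AE_all_countable) (auto intro!: AE_not_in null_setsI simp: emeasure_eq_measure)
  then show ?thesis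
  proof (rule AE_mp, intro AE_I2 impI notI)
    fix x assume x: "x \<in> space M" "\<forall>s. x \<notin> G s" and sm: "summable (\<lambda>n. 1 / D n x)"
    obtain s :: nat where s: "(\<Sum>n. 1 / D n x) \<le> real s" using real_arch_simple by blast
    have "(\<Sum>n<N. 1 / D n x) \<le> real s" for N
      using sum_le_suminf[OF sm, of "{..<N}"] pos s by (fastforce intro: less_imp_le)
    then have "x \<in> G s" using x by (simp add: G_def)
    then show False using x by simp
  qed
qed

definition near_integer :: "nat \<Rightarrow> real \<Rightarrow> real set" where
  "near_integer m \<epsilon> = {\<alpha> \<in> {0..<1}. \<exists>p::int. \<bar>real m * \<alpha> - of_int p\<bar> \<le> \<epsilon>}"

lemma near_integer_sets [measurable]: "near_integer m \<epsilon> \<in> sets circle_measure"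
proof -
  have "near_integer m \<epsilon> = {0..<1} \<inter> (\<Union>p::int. {\<alpha>. \<bar>real m * \<alpha> - of_int p\<bar> \<le> \<epsilon>})"
    by (auto simp: near_integer_def)
  also have "\<dots> \<in> sets borel" by measurable
  finally show ?thesis by (auto simp: sets_circle near_integer_def)
qed

lemma near_integer_Int_space [simp]: "near_integer m \<epsilon> \<inter> {0..<1} = near_integer m \<epsilon>"
  by (auto simp: near_integer_def)

lemma measure_near_integer:
  assumes m: "0 < m" and \<epsilon>: "0 \<le> \<epsilon>"
  shows "measure circle_measure (near_integer m \<epsilon>) \<le> 4 * \<epsilon>"
proof (cases "\<epsilon> < 1")
  case False
  then show ?thesis using circle.bounded_measure[of "near_integer m \<epsilon>"] by simp
next
  case True
  have "near_integer m \<epsilon> \<subseteq> (\<Union>p\<in>{0..int m}. {(of_int p - \<epsilon>) / m..(of_int p + \<epsilon>) / m})"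
  proof
    fix \<alpha> assume "\<alpha> \<in> near_integer m \<epsilon>"
    then obtain p :: int where \<alpha>: "0 \<le> \<alpha>" "\<alpha> < 1" and p: "\<bar>real m * \<alpha> - of_int p\<bar> \<le> \<epsilon>"
      by (auto simp: near_integer_def)
    have "0 \<le> real m * \<alpha>" "real m * \<alpha> < real m" using \<alpha> m by auto
    then have "- 1 < real_of_int p" "real_of_int p < real m + 1" using p True by linarith+
    then have "0 \<le> p \<and> p \<le> int m" by linarith
    moreover have "\<alpha> \<in> {(of_int p - \<epsilon>) / m..(of_int p + \<epsilon>) / m}"
      using p m by (simp add: field_simps abs_le_iff)
    ultimately show "\<alpha> \<in> (\<Union>p\<in>{0..int m}. {(of_int p - \<epsilon>) / m..(of_int p + \<epsilon>) / m})" by auto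
  qed
  then have "emeasure lborel (near_integer m \<epsilon>) \<le> emeasure lborel (\<Union>p\<in>{0..int m}. {(of_int p - \<epsilon>) / m..(of_int p + \<epsilon>) / m})"
    by (intro emeasure_mono) auto
  also have "\<dots> \<le> (\<Sum>p\<in>{0..int m}. emeasure lborel {(of_int p - \<epsilon>) / m..(of_int p + \<epsilon>) / m})"
    by (intro emeasure_subadditive_finite) auto
  also have "\<dots> = (\<Sum>p\<in>{0..int m}. ennreal (2 * \<epsilon> / m))"
    using m \<epsilon> by (intro sum.cong refl, subst emeasure_lborel_Icc) (auto simp: divide_right_mono field_simps)
  also have "\<dots> = ennreal ((real m + 1) * (2 * \<epsilon> / m))"
    using \<epsilon> by (simp add: ennreal_of_nat_eq_real_of_nat ennreal_mult'[symmetric] add.commute del: ennreal_plus)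
  also have "\<dots> \<le> ennreal (4 * \<epsilon>)"
  proof (rule ennreal_leI)
    have "(real m + 1) * (2 * \<epsilon>) \<le> (2 * real m) * (2 * \<epsilon>)" using m \<epsilon> by (intro mult_right_mono) auto
    then show "(real m + 1) * (2 * \<epsilon> / m) \<le> 4 * \<epsilon>" using m by (simp add: field_simps)
  qed
  finally have "emeasure circle_measure (near_integer m \<epsilon>) \<le> ennreal (4 * \<epsilon>)"
    by (subst emeasure_circle) (auto simp: near_integer_def)
  then show ?thesis using \<epsilon> by (simp add: circle.emeasure_eq_measure)
qed

text \<open>
  Any \<open>Q \<le> 2 ^ j\<close> for which \<open>Q * \<alpha>\<close> is within \<open>1 / 2 ^ j\<close> of an integer has \<open>2 ^ j / Q\<close> among the terms
  of this sum, unless it is smaller than \<open>2 ^ j / (j+1)\<^sup>2\<close>. Unlike \<open>2 ^ j / Q\<close> itself, whose mean grows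
  linearly in \<open>j\<close> for the least such \<open>Q\<close>, the truncated sum has a mean of order \<open>ln j\<close>.
\<close>

definition dyadic_ratio :: "nat \<Rightarrow> real \<Rightarrow> real" where
  "dyadic_ratio j \<alpha> = (\<Sum>m | 0 < m \<and> m \<le> 2 ^ j \<and> real (2 ^ j) \<le> (real j + 1)\<^sup>2 * real m.
      2 ^ j / real m * indicator (near_integer m (1 / 2 ^ j)) \<alpha>)"

lemma finite_dyadic_range: "finite {m::nat. 0 < m \<and> m \<le> 2 ^ j \<and> P m}"
  by (rule finite_subset[of _ "{..2 ^ j}"]) auto

lemma dyadic_ratio_measurable [measurable]: "dyadic_ratio j \<in> borel_measurable circle_measure"
  unfolding dyadic_ratio_def by measurable

lemma dyadic_ratio_nonneg: "0 \<le> dyadic_ratio j \<alpha>"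
  unfolding dyadic_ratio_def by (intro sum_nonneg) auto

lemma dyadic_ratio_integral:
  "integrable circle_measure (dyadic_ratio j)"
  "(\<integral>\<alpha>. dyadic_ratio j \<alpha> \<partial>circle_measure) \<le> 4 * (1 + 2 * ln (real j + 1))"
proof -
  show "integrable circle_measure (dyadic_ratio j)"
    unfolding dyadic_ratio_def by (intro Bochner_Integration.integrable_sum integrable_mult_right) (auto simp: circle.emeasure_eq_measure)
  define S where "S = {m. 0 < m \<and> m \<le> 2 ^ j \<and> real (2 ^ j) \<le> (real j + 1)\<^sup>2 * real m}"
  have "(\<integral>\<alpha>. dyadic_ratio j \<alpha> \<partial>circle_measure)
      = (\<Sum>m\<in>S. 2 ^ j / real m * measure circle_measure (near_integer m (1 / 2 ^ j)))"
    unfolding dyadic_ratio_def S_def[symmetric]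
    by (subst Bochner_Integration.integral_sum) (auto simp: circle.emeasure_eq_measure)
  also have "\<dots> \<le> (\<Sum>m\<in>S. 2 ^ j / real m * (4 * (1 / 2 ^ j)))"
    by (intro sum_mono mult_left_mono measure_near_integer) (auto simp: S_def)
  also have "\<dots> = 4 * (\<Sum>m\<in>S. 1 / real m)" by (simp add: sum_distrib_left)
  also have "\<dots> \<le> 4 * (1 + ln ((real j + 1)\<^sup>2))"
  proof (intro mult_left_mono sum_inverse_le_ln)
    show "1 \<le> (real j + 1)\<^sup>2" by (simp add: one_le_power)
  qed (auto simp: S_def)
  also have "\<dots> = 4 * (1 + 2 * ln (real j + 1))" by (simp add: ln_realpow)
  finally show "(\<integral>\<alpha>. dyadic_ratio j \<alpha> \<partial>circle_measure) \<le> 4 * (1 + 2 * ln (real j + 1))" .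
qed

text \<open>
  For each \<open>m\<close> the set of exceptional \<open>\<alpha>\<close> has measure at most \<open>4 / 2 ^ j\<close>, and there are fewer than
  \<open>2 ^ j / (j+1)\<^sup>2\<close> candidates \<open>m\<close>; the Borel--Cantelli lemma applies.
\<close>

lemma AE_no_small_denominator:
  "AE \<alpha> in circle_measure. eventually (\<lambda>j. \<forall>m. 0 < m \<and> (\<exists>p::int. \<bar>real m * \<alpha> - of_int p\<bar> \<le> 1 / 2 ^ j)
      \<longrightarrow> real (2 ^ j) \<le> (real j + 1)\<^sup>2 * real m) sequentially"
proof -
  define S where "S j = {m::nat. 0 < m \<and> (real j + 1)\<^sup>2 * real m < real (2 ^ j)}" for j :: nat
  define A where "A j = (\<Union>m\<in>S j. near_integer m (1 / 2 ^ j))" for j :: nat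
  have sub: "S j \<subseteq> {0<..nat \<lfloor>2 ^ j / (real j + 1)\<^sup>2\<rfloor>}" for j
  proof
    fix m assume "m \<in> S j"
    then have m: "0 < m" "(real j + 1)\<^sup>2 * real m < 2 ^ j" by (auto simp: S_def)
    have "0 < (real j + 1)\<^sup>2" by (simp add: add_nonneg_pos)
    then have "real m \<le> 2 ^ j / (real j + 1)\<^sup>2" using m(2) by (simp add: pos_le_divide_eq mult.commute)
    then show "m \<in> {0<..nat \<lfloor>2 ^ j / (real j + 1)\<^sup>2\<rfloor>}" using m(1) by (simp add: le_nat_floor)
  qed
  have fin: "finite (S j)" for j using sub by (rule finite_subset) simp
  have card: "real (card (S j)) \<le> 2 ^ j / (real j + 1)\<^sup>2" for j
  proof -
    have "card (S j) \<le> nat \<lfloor>2 ^ j / (real j + 1)\<^sup>2\<rfloor>" using card_mono[OF _ sub[of j]] by simp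
    then have "real (card (S j)) \<le> of_int \<lfloor>2 ^ j / (real j + 1)\<^sup>2\<rfloor>" by (simp add: le_nat_iff)
    then show ?thesis by linarith
  qed
  have A [measurable]: "A j \<in> sets circle_measure" for j
    unfolding A_def using fin by (intro sets.finite_UN) auto
  have meas_A: "measure circle_measure (A j) \<le> 4 * inverse (real (Suc j) ^ 2)" for j
  proof -
    have "measure circle_measure (A j) \<le> (\<Sum>m\<in>S j. measure circle_measure (near_integer m (1 / 2 ^ j)))"
      unfolding A_def using fin by (intro circle.finite_measure_subadditive_finite) auto
    also have "\<dots> \<le> (\<Sum>m\<in>S j. 4 * (1 / 2 ^ j))"
      by (intro sum_mono measure_near_integer) (auto simp: S_def)
    also have "\<dots> = real (card (S j)) * (4 * (1 / 2 ^ j))" by simp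
    also have "\<dots> \<le> 2 ^ j / (real j + 1)\<^sup>2 * (4 * (1 / 2 ^ j))" by (intro mult_right_mono card) auto
    also have "\<dots> = 4 * inverse (real (Suc j) ^ 2)" by (simp add: field_simps)
    finally show ?thesis .
  qed
  have "summable (\<lambda>j. 4 * inverse (real (Suc j) ^ 2))"
  proof -
    have "summable (\<lambda>j. inverse (real (Suc j) ^ 2))"
      by (subst summable_Suc_iff) (rule inverse_power_summable, simp)
    then show ?thesis by (rule summable_mult)
  qed
  then have "summable (\<lambda>j. measure circle_measure (A j))"
  proof (rule summable_comparison_test')
    show "norm (measure circle_measure (A j)) \<le> 4 * inverse (real (Suc j) ^ 2)" if "0 \<le> j" for j
      using meas_A[of j] by (simp only: real_norm_def abs_of_nonneg[OF measure_nonneg])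
  qed
  then have "AE \<alpha> in circle_measure. eventually (\<lambda>j. \<alpha> \<in> space circle_measure - A j) sequentially"
    by (intro borel_cantelli_AE1) (auto simp: circle.emeasure_eq_measure)
  then show ?thesis
  proof eventually_elim
    case (elim \<alpha>)
    then show ?case
    proof (rule eventually_mono, intro allI impI)
      fix j m assume \<alpha>: "\<alpha> \<in> space circle_measure - A j"
        and m: "0 < m \<and> (\<exists>p::int. \<bar>real m * \<alpha> - of_int p\<bar> \<le> 1 / 2 ^ j)"
      then have "\<alpha> \<in> near_integer m (1 / 2 ^ j)" by (simp add: near_integer_def)
      then have "m \<notin> S j" using \<alpha> by (auto simp: A_def)
      then show "real (2 ^ j) \<le> (real j + 1)\<^sup>2 * real m" using m by (simp add: S_def)
    qed
  qed
qed

text \<open>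
  By the truncation, the sums of \<open>2 ^ j / Q j\<close> over \<open>j < n\<close> are dominated, up to a constant factor that
  depends on \<open>\<alpha>\<close>, by functions \<open>D n\<close> with mean of order \<open>n * ln n\<close>, and the series of
  \<open>1 / (n * ln n)\<close> diverges.
\<close>

theorem AE_dyadic_denominators:
  "AE \<alpha> in circle_measure. \<forall>Q. (\<forall>j. 0 < Q j \<and> Q j \<le> 2 ^ j \<and> (\<exists>p::int. \<bar>real (Q j) * \<alpha> - of_int p\<bar> \<le> 1 / 2 ^ j))
      \<longrightarrow> \<not> summable (\<lambda>n. 1 / (1 + (\<Sum>j<n. 2 ^ j / real (Q j))))"
proof -
  define D where "D n \<alpha> = 1 + (\<Sum>j<n. dyadic_ratio j \<alpha>)" for n \<alpha>
  have D1: "1 \<le> D n \<alpha>" for n \<alpha> unfolding D_def using dyadic_ratio_nonneg by (simp add: sum_nonneg)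
  have "AE \<alpha> in circle_measure. \<not> summable (\<lambda>n. 1 / D n \<alpha>)"
  proof (rule circle.inverse_series_diverges[where c = 16 and w = "\<lambda>n. 1 / (real (n + 2) * ln (real (n + 2)))"])
    show "D n \<in> borel_measurable circle_measure" for n unfolding D_def by measurable
    show "0 < D n x" for n x using D1[of n x] by linarith
    show "integrable circle_measure (D n)" for n
      unfolding D_def by (intro Bochner_Integration.integrable_add Bochner_Integration.integrable_sum dyadic_ratio_integral) auto
    show "0 < 1 / (real (n + 2) * ln (real (n + 2)))" for n by (intro divide_pos_pos mult_pos_pos ln_gt_zero) auto
    show "\<not> summable (\<lambda>n. 1 / (real (n + 2) * ln (real (n + 2))))" by (rule not_summable_n_ln_n)
    show "(\<integral>\<alpha>. D n \<alpha> \<partial>circle_measure) \<le> 16 / (1 / (real (n + 2) * ln (real (n + 2))))" for n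
    proof -
      define L where "L = ln (real n + 2)"
      have "(\<integral>\<alpha>. D n \<alpha> \<partial>circle_measure) = 1 + (\<Sum>j<n. (\<integral>\<alpha>. dyadic_ratio j \<alpha> \<partial>circle_measure))"
        unfolding D_def by (subst Bochner_Integration.integral_add) (auto simp: dyadic_ratio_integral)
      also have "(\<Sum>j<n. (\<integral>\<alpha>. dyadic_ratio j \<alpha> \<partial>circle_measure)) \<le> (\<Sum>j<n. 4 * (1 + 2 * L))"
      proof (rule sum_mono)
        fix j assume "j \<in> {..<n}"
        then have "ln (real j + 1) \<le> L" unfolding L_def by (intro ln_mono) auto
        then show "(\<integral>\<alpha>. dyadic_ratio j \<alpha> \<partial>circle_measure) \<le> 4 * (1 + 2 * L)"
          by (intro order_trans[OF dyadic_ratio_integral(2)]) simp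
      qed
      finally have le: "(\<integral>\<alpha>. D n \<alpha> \<partial>circle_measure) \<le> 1 + 4 * real n + 8 * (real n * L)" by (simp add: algebra_simps)
      have "1 / 2 \<le> ln (2::real)" using ln2_ge_two_thirds by linarith
      also have "\<dots> \<le> L" unfolding L_def by (intro ln_mono) auto
      finally have L: "1 / 2 \<le> L" .
      then have "real n * (1 / 2) \<le> real n * L" by (intro mult_left_mono) auto
      then have "1 + 4 * real n + 8 * (real n * L) \<le> 16 * ((real n + 2) * L)"
        using L by (simp add: algebra_simps)
      then have "(\<integral>\<alpha>. D n \<alpha> \<partial>circle_measure) \<le> 16 * ((real n + 2) * L)" using le by linarith
      then show ?thesis by (simp add: L_def add.commute)
    qed
  qed simp
  with AE_no_small_denominator AE_space show ?thesis
  proof (eventually_elim, intro impI allI notI)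
    fix \<alpha> and Q :: "nat \<Rightarrow> nat"
    let ?E = "\<lambda>n. 2 ^ n / real (Q n)"
    assume ev: "\<forall>\<^sub>F j in sequentially. \<forall>m. 0 < m \<and> (\<exists>p::int. \<bar>real m * \<alpha> - of_int p\<bar> \<le> 1 / 2 ^ j)
            \<longrightarrow> real (2 ^ j) \<le> (real j + 1)\<^sup>2 * real m"
      and \<alpha>: "\<alpha> \<in> space circle_measure" and ns: "\<not> summable (\<lambda>n. 1 / D n \<alpha>)"
      and Q: "\<forall>j. 0 < Q j \<and> Q j \<le> 2 ^ j \<and> (\<exists>p::int. \<bar>real (Q j) * \<alpha> - of_int p\<bar> \<le> 1 / 2 ^ j)"
      and sm: "summable (\<lambda>n. 1 / (1 + (\<Sum>j<n. ?E j)))"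
    obtain J where J: "\<And>j m. j \<ge> J \<Longrightarrow> 0 < m \<Longrightarrow> \<exists>p::int. \<bar>real m * \<alpha> - of_int p\<bar> \<le> 1 / 2 ^ j
        \<Longrightarrow> real (2 ^ j) \<le> (real j + 1)\<^sup>2 * real m"
      using ev unfolding eventually_sequentially by blast
    have big: "?E j \<le> dyadic_ratio j \<alpha>" if "j \<ge> J" for j
    proof -
      have near: "\<alpha> \<in> near_integer (Q j) (1 / 2 ^ j)" using Q \<alpha> by (auto simp: near_integer_def)
      have "Q j \<in> {m. 0 < m \<and> m \<le> 2 ^ j \<and> real (2 ^ j) \<le> (real j + 1)\<^sup>2 * real m}"
        using Q J[OF that] by blast
      then have "2 ^ j / real (Q j) * indicator (near_integer (Q j) (1 / 2 ^ j)) \<alpha> \<le> dyadic_ratio j \<alpha>"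
        unfolding dyadic_ratio_def by (intro member_le_sum finite_dyadic_range) auto
      then show ?thesis using near by simp
    qed
    \<comment> \<open>\<open>H\<close> absorbs the finitely many scales at which the truncation is not yet effective.\<close>
    define H where "H = (\<Sum>j<J. ?E j)"
    have H: "0 \<le> H" unfolding H_def by (intro sum_nonneg) auto
    have "1 + (\<Sum>j<n. ?E j) \<le> (1 + H) * D n \<alpha>" for n
    proof -
      have "?E j \<le> (if j < J then ?E j else 0) + dyadic_ratio j \<alpha>" for j
        using big[of j] dyadic_ratio_nonneg[of j \<alpha>] by auto
      then have "(\<Sum>j<n. ?E j) \<le> (\<Sum>j<n. (if j < J then ?E j else 0) + dyadic_ratio j \<alpha>)" by (intro sum_mono)
      also have "\<dots> = (\<Sum>j | j < n \<and> j < J. ?E j) + (\<Sum>j<n. dyadic_ratio j \<alpha>)"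
        by (simp add: sum.distrib sum.inter_filter[symmetric])
      also have "(\<Sum>j | j < n \<and> j < J. ?E j) \<le> H" unfolding H_def by (intro sum_mono2) auto
      finally have "1 + (\<Sum>j<n. ?E j) \<le> H * 1 + D n \<alpha>" by (simp add: D_def)
      also have "\<dots> \<le> H * D n \<alpha> + D n \<alpha>" using H D1 by (intro add_mono mult_left_mono) auto
      finally show ?thesis by (simp add: algebra_simps)
    qed
    then have "1 / ((1 + H) * D n \<alpha>) \<le> 1 / (1 + (\<Sum>j<n. ?E j))" for n
      using H D1[of n \<alpha>] by (intro divide_left_mono mult_pos_pos add_pos_nonneg sum_nonneg) auto
    moreover have "0 \<le> 1 / ((1 + H) * D n \<alpha>)" for n using H D1[of n \<alpha>] by simp
    ultimately have "summable (\<lambda>n. 1 / ((1 + H) * D n \<alpha>))"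
      by (intro summable_comparison_test'[OF sm, of 0]) (simp only: real_norm_def abs_of_nonneg)
    then have "summable (\<lambda>n. (1 + H) * (1 / ((1 + H) * D n \<alpha>)))" by (rule summable_mult)
    then show False using ns H by simp
  qed
qed

section \<open>Counting returns to a set\<close>

definition return_measure :: "(real \<Rightarrow> int) \<Rightarrow> real \<Rightarrow> real set \<Rightarrow> nat \<Rightarrow> real" where
  "return_measure f \<alpha> E d =
     measure circle_measure {y \<in> E. frac (y + real d * \<alpha>) \<in> E \<and> rotation_sum f \<alpha> d y = 0}"

lemma rotation_sum_measurable [measurable]:
  fixes f :: "real \<Rightarrow> int"
  assumes [measurable]: "f \<in> measurable borel (count_space UNIV)"
  shows "rotation_sum f \<alpha> k \<in> measurable borel (count_space UNIV)"
proof (induction k)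
  case (Suc k)
  note [measurable] = Suc
  have "rotation_sum f \<alpha> (Suc k) = (\<lambda>y. rotation_sum f \<alpha> k y + f (y + real k * \<alpha>))"
    by (auto simp: rotation_sum_def)
  then show ?case by simp
qed (simp add: rotation_sum_def[abs_def])

text \<open>
  The Cauchy--Schwarz inequality for the weights \<open>c v\<close> of the level sets of \<open>s\<close>, in the form
  \<open>(c v)\<^sup>2 \<ge> 2 * t * c v - t\<^sup>2\<close>: being linear in \<open>h\<close> on the left, it can be integrated when \<open>h\<close>
  depends on a parameter, and \<open>t\<close> chosen afterwards.
\<close>

lemma sum_squares_level_counts:
  fixes h :: "nat \<Rightarrow> real" and s :: "nat \<Rightarrow> int"
  assumes V: "finite V" "\<And>k. k < N \<Longrightarrow> s k \<in> V"
  shows "2 * t * (\<Sum>k<N. h k) - t\<^sup>2 * real (card V)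
     \<le> (\<Sum>i<N. \<Sum>j<N. if s i = s j then h i * h j else 0)"
proof -
  define c where "c v = (\<Sum>k<N. if s k = v then h k else 0)" for v
  have "(\<Sum>v\<in>V. c v) = (\<Sum>k<N. \<Sum>v\<in>V. if s k = v then h k else 0)"
    unfolding c_def by (rule sum.swap)
  also have "\<dots> = (\<Sum>k<N. h k)" using V by (intro sum.cong) auto
  finally have lin: "(\<Sum>v\<in>V. c v) = (\<Sum>k<N. h k)" .
  have "(\<Sum>v\<in>V. (c v)\<^sup>2)
      = (\<Sum>v\<in>V. \<Sum>i<N. \<Sum>j<N. (if s i = v then h i else 0) * (if s j = v then h j else 0))"
    unfolding c_def power2_eq_square by (simp add: sum_product)
  also have "\<dots> = (\<Sum>i<N. \<Sum>v\<in>V. \<Sum>j<N. (if s i = v then h i else 0) * (if s j = v then h j else 0))"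
    by (rule sum.swap)
  also have "\<dots> = (\<Sum>i<N. \<Sum>j<N. \<Sum>v\<in>V. (if s i = v then h i else 0) * (if s j = v then h j else 0))"
    by (intro sum.cong refl sum.swap)
  also have "\<dots> = (\<Sum>i<N. \<Sum>j<N. if s i = s j then h i * h j else 0)"
  proof (intro sum.cong refl)
    fix i j assume i: "i \<in> {..<N}"
    have "(\<Sum>v\<in>V. (if s i = v then h i else 0) * (if s j = v then h j else 0))
        = (\<Sum>v\<in>V. if s i = v then (if s i = s j then h i * h j else 0) else 0)"
      by (intro sum.cong) auto
    then show "(\<Sum>v\<in>V. (if s i = v then h i else 0) * (if s j = v then h j else 0))
        = (if s i = s j then h i * h j else 0)"
      using V i by simp
  qed
  finally have quad: "(\<Sum>v\<in>V. (c v)\<^sup>2) = (\<Sum>i<N. \<Sum>j<N. if s i = s j then h i * h j else 0)" .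
  have "(\<Sum>v\<in>V. 2 * t * c v - t\<^sup>2) \<le> (\<Sum>v\<in>V. (c v)\<^sup>2)"
  proof (rule sum_mono)
    fix v
    have "0 \<le> (c v - t)\<^sup>2" by simp
    then show "2 * t * c v - t\<^sup>2 \<le> (c v)\<^sup>2" by (simp add: power2_diff algebra_simps)
  qed
  also have "(\<Sum>v\<in>V. 2 * t * c v - t\<^sup>2) = 2 * t * (\<Sum>v\<in>V. c v) - t\<^sup>2 * real (card V)"
    by (simp add: sum_subtractf sum_distrib_left mult.commute[of "t\<^sup>2"])
  finally show ?thesis unfolding quad lin .
qed

lemma sum_differences_le:
  fixes b :: "nat \<Rightarrow> real"
  assumes b: "\<And>d. 0 \<le> b d" and i: "i < N"
  shows "(\<Sum>j<N. b (if i \<le> j then j - i else i - j)) \<le> 2 * (\<Sum>d<N. b d)"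
proof -
  have "(\<Sum>j<N. b (if i \<le> j then j - i else i - j))
      = (\<Sum>j\<in>{..<i} \<union> {i..<N}. b (if i \<le> j then j - i else i - j))"
    using i by (intro sum.cong) auto
  also have "\<dots> = (\<Sum>j<i. b (i - j)) + (\<Sum>j\<in>{i..<N}. b (j - i))"
    by (subst sum.union_disjoint) (auto intro!: arg_cong2[where f = "(+)"] sum.cong)
  also have "(\<Sum>j<i. b (i - j)) = (\<Sum>d\<in>(\<lambda>j. i - j) ` {..<i}. b d)"
    by (subst sum.reindex) (auto simp: inj_on_def)
  also have "\<dots> \<le> (\<Sum>d<N. b d)" using b i by (intro sum_mono2) auto
  also have "(\<Sum>j\<in>{i..<N}. b (j - i)) = (\<Sum>d\<in>(\<lambda>j. j - i) ` {i..<N}. b d)"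
    by (subst sum.reindex) (auto simp: inj_on_def)
  also have "\<dots> \<le> (\<Sum>d<N. b d)" using b i by (intro sum_mono2) auto
  finally show ?thesis by simp
qed

text \<open>
  On average over the orbits, of the first \<open>N\<close> points exactly \<open>N * measure E\<close> lie over
  \<open>E\<close>, and they are spread over at most \<open>2 * R + 1\<close> levels. So many pairs of times \<open>i, j\<close> see the same level over \<open>E\<close>. By invariance of
  the measure, such a coincidence is as likely as a return to \<open>E\<close> at level \<open>0\<close> after \<open>\<bar>i - j\<bar>\<close> steps.
\<close>

theorem return_measure_lower_bound:
  fixes f :: "real \<Rightarrow> int"
  assumes per: "\<And>x. f (x + 1) = f x" and f [measurable]: "f \<in> measurable borel (count_space UNIV)"
    and E: "E \<in> sets circle_measure" and N: "0 < N" and R: "0 \<le> R"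
    and bound: "\<And>k y. k < N \<Longrightarrow> \<bar>real_of_int (rotation_sum f \<alpha> k y)\<bar> \<le> R"
  shows "(measure circle_measure E)\<^sup>2 / 2 * (real N / (2 * R + 1)) \<le> (\<Sum>d<N. return_measure f \<alpha> E d)"
proof -
  have [measurable]: "E \<in> sets borel" and E01: "E \<subseteq> {0..<1}" using E by (auto simp: sets_circle)
  define \<beta> where "\<beta> = measure circle_measure E"
  \<comment> \<open>The indicator of \<open>E\<close>, extended to a periodic function on the line.\<close>
  define h :: "real \<Rightarrow> real" where "h y = indicator E (frac y)" for y
  define \<phi> where "\<phi> d y = (if rotation_sum f \<alpha> d y = 0 then h y * h (y + real d * \<alpha>) else 0)" for d y
  have h_per: "h (y + 1) = h y" for y by (simp add: h_def frac_1_eq)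
  have [measurable]: "h \<in> borel_measurable borel" unfolding h_def by measurable
  have \<phi>_per: "\<phi> d (y + 1) = \<phi> d y" for d y
    using h_per[of y] h_per[of "y + real d * \<alpha>"] rotation_sum_periodic[of f \<alpha> d y, OF per]
    by (simp add: \<phi>_def add_ac)
  have \<phi>_meas [measurable]: "\<phi> d \<in> borel_measurable borel" for d unfolding \<phi>_def by measurable
  have h01: "0 \<le> h y" "h y \<le> 1" for y by (auto simp: h_def)
  have bounded_int: "integrable circle_measure (\<lambda>y. g (y + s))"
    if "g \<in> borel_measurable borel" "\<And>y. \<bar>g y\<bar> \<le> 1" for g :: "real \<Rightarrow> real" and s
    using that by (intro circle.integrable_const_bound[where B = 1] borel_measurable_circle) auto
  have \<phi>_int: "integrable circle_measure (\<lambda>y. \<phi> d (y + s))" for d s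
    using h01 by (intro bounded_int) (auto simp: \<phi>_def abs_mult intro!: mult_le_one)
  have h_int: "integrable circle_measure (\<lambda>y. h (y + s))" for s
    using h01 by (intro bounded_int) auto
  have frac_id: "frac y = y" if "y \<in> {0..<1}" for y :: real using that by (simp add: frac_eq)
  have int_h: "(\<integral>y. h (y + s) \<partial>circle_measure) = \<beta>" for s
  proof -
    have "(\<integral>y. h (y + s) \<partial>circle_measure) = (\<integral>y. h y \<partial>circle_measure)"
      by (rule integral_rotation[of h, OF h_per]) measurable
    also have "\<dots> = (\<integral>y. indicator E y \<partial>circle_measure)"
      by (intro Bochner_Integration.integral_cong) (auto simp: h_def frac_id)
    also have "\<dots> = \<beta>" using E E01 by (simp add: \<beta>_def Int_absorb2)
    finally show ?thesis .
  qed
  have int_\<phi>: "(\<integral>y. \<phi> d (y + s) \<partial>circle_measure) = return_measure f \<alpha> E d" for d s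
  proof -
    define F where "F = {y \<in> E. frac (y + real d * \<alpha>) \<in> E \<and> rotation_sum f \<alpha> d y = 0}"
    have "F = E \<inter> {y. frac (y + real d * \<alpha>) \<in> E \<and> rotation_sum f \<alpha> d y = 0}" by (auto simp: F_def)
    also have "\<dots> \<in> sets borel" by measurable
    finally have F: "F \<in> sets circle_measure" using E01 by (auto simp: sets_circle F_def)
    have F01: "F \<subseteq> {0..<1}" using E01 by (auto simp: F_def)
    have "(\<integral>y. \<phi> d (y + s) \<partial>circle_measure) = (\<integral>y. \<phi> d y \<partial>circle_measure)"
      by (rule integral_rotation[of "\<phi> d", OF \<phi>_per]) measurable
    also have "\<dots> = (\<integral>y. indicator F y \<partial>circle_measure)"
      by (intro Bochner_Integration.integral_cong) (auto simp: \<phi>_def h_def frac_id F_def indicator_def)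
    also have "\<dots> = measure circle_measure F" using F F01 by (simp add: Int_absorb2)
    finally show ?thesis by (simp add: return_measure_def F_def)
  qed
  define dist where "dist i j = (if i \<le> j then j - i else i - j)" for i j :: nat
  have pair: "(if rotation_sum f \<alpha> i y = rotation_sum f \<alpha> j y then h (y + real i * \<alpha>) * h (y + real j * \<alpha>) else 0)
      = \<phi> (dist i j) (y + real (min i j) * \<alpha>)" for i j y
  proof -
    have "(if rotation_sum f \<alpha> i y = rotation_sum f \<alpha> (i + d) y then h (y + real i * \<alpha>) * h (y + real (i + d) * \<alpha>) else 0)
      = \<phi> d (y + real i * \<alpha>)" for i d
      using rotation_sum_add[of f \<alpha> i d y] by (simp add: \<phi>_def distrib_right add.assoc)
    from this[of i "j - i"] this[of j "i - j"] show ?thesis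
      by (cases "i \<le> j") (auto simp: dist_def min_def mult.commute)
  qed
  define V where "V = {- \<lfloor>R\<rfloor>..\<lfloor>R\<rfloor>}"
  have V: "rotation_sum f \<alpha> k y \<in> V" if "k < N" for k y
  proof -
    have "real_of_int (rotation_sum f \<alpha> k y) \<le> R" "real_of_int (- rotation_sum f \<alpha> k y) \<le> R"
      using bound[OF that, of y] by auto
    then have "rotation_sum f \<alpha> k y \<le> \<lfloor>R\<rfloor>" "- rotation_sum f \<alpha> k y \<le> \<lfloor>R\<rfloor>"
      by (simp_all only: le_floor_iff)
    then show ?thesis by (simp add: V_def)
  qed
  have cardV: "real (card V) \<le> 2 * R + 1"
  proof -
    have "0 \<le> \<lfloor>R\<rfloor>" using R by simp
    then have "real (card V) = 2 * of_int \<lfloor>R\<rfloor> + 1" by (simp add: V_def)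
    then show ?thesis by linarith
  qed
  \<comment> \<open>The mean number of visits to \<open>E\<close> per level, which maximises the quadratic lower bound.\<close>
  define t where "t = real N * \<beta> / (2 * R + 1)"
  have "2 * t * (\<Sum>k<N. h (y + real k * \<alpha>)) - t\<^sup>2 * (2 * R + 1)
      \<le> (\<Sum>i<N. \<Sum>j<N. \<phi> (dist i j) (y + real (min i j) * \<alpha>))" for y
  proof -
    have "2 * t * (\<Sum>k<N. h (y + real k * \<alpha>)) - t\<^sup>2 * real (card V)
        \<le> (\<Sum>i<N. \<Sum>j<N. \<phi> (dist i j) (y + real (min i j) * \<alpha>))"
      unfolding pair[symmetric] by (rule sum_squares_level_counts) (use V in \<open>auto simp: V_def\<close>)
    moreover have "t\<^sup>2 * real (card V) \<le> t\<^sup>2 * (2 * R + 1)" using cardV by (intro mult_left_mono) auto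
    ultimately show ?thesis by linarith
  qed
  then have "(\<integral>y. 2 * t * (\<Sum>k<N. h (y + real k * \<alpha>)) - t\<^sup>2 * (2 * R + 1) \<partial>circle_measure)
      \<le> (\<integral>y. (\<Sum>i<N. \<Sum>j<N. \<phi> (dist i j) (y + real (min i j) * \<alpha>)) \<partial>circle_measure)"
    using h_int \<phi>_int
    by (intro integral_mono Bochner_Integration.integrable_diff Bochner_Integration.integrable_sum
        integrable_mult_right) auto
  also have "(\<integral>y. 2 * t * (\<Sum>k<N. h (y + real k * \<alpha>)) - t\<^sup>2 * (2 * R + 1) \<partial>circle_measure)
      = 2 * t * (real N * \<beta>) - t\<^sup>2 * (2 * R + 1)"
    using h_int by (subst Bochner_Integration.integral_diff) (auto simp: int_h Bochner_Integration.integral_sum)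
  also have "(\<integral>y. (\<Sum>i<N. \<Sum>j<N. \<phi> (dist i j) (y + real (min i j) * \<alpha>)) \<partial>circle_measure)
      = (\<Sum>i<N. \<Sum>j<N. return_measure f \<alpha> E (dist i j))"
    using \<phi>_int by (simp add: Bochner_Integration.integral_sum int_\<phi>)
  also have "\<dots> \<le> (\<Sum>i<N. 2 * (\<Sum>d<N. return_measure f \<alpha> E d))"
    unfolding dist_def by (intro sum_mono sum_differences_le) (auto simp: return_measure_def)
  also have "\<dots> = real N * (2 * (\<Sum>d<N. return_measure f \<alpha> E d))" by simp
  also have "2 * t * (real N * \<beta>) - t\<^sup>2 * (2 * R + 1) = real N * (real N * \<beta>\<^sup>2 / (2 * R + 1))"
  proof -
    have "t * (2 * R + 1) = real N * \<beta>" using R by (simp add: t_def)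
    then have "2 * t * (real N * \<beta>) - t\<^sup>2 * (2 * R + 1) = t * (real N * \<beta>)"
      by (simp add: power2_eq_square mult.assoc)
    then show ?thesis by (simp add: t_def power2_eq_square mult_ac)
  qed
  finally have le: "real N * \<beta>\<^sup>2 / (2 * R + 1) \<le> 2 * (\<Sum>d<N. return_measure f \<alpha> E d)"
    by (rule mult_left_le_imp_le) (use N in simp)
  have "\<beta>\<^sup>2 / 2 * (real N / (2 * R + 1)) = real N * \<beta>\<^sup>2 / (2 * R + 1) / 2"
    by (simp add: mult.commute)
  also have "\<dots> \<le> 2 * (\<Sum>d<N. return_measure f \<alpha> E d) / 2"
    using le by (rule divide_right_mono) simp
  also have "\<dots> = (\<Sum>d<N. return_measure f \<alpha> E d)" by simp
  finally show ?thesis by (simp only: \<beta>_def)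
qed

lemma sum_dyadic_tail_le:
  fixes d :: nat
  assumes "0 < d"
  shows "(\<Sum>n<K. if d < 2 ^ n then 1 / 2 ^ n else 0) \<le> 2 / real d"
proof -
  \<comment> \<open>Once a term is nonzero, the remainder \<open>2 / 2 ^ K\<close> of the geometric series is kept on the left.\<close>
  have "if d < 2 ^ K then (\<Sum>n<K. if d < 2 ^ n then 1 / 2 ^ n else 0) + 2 / 2 ^ K \<le> 2 / real d
        else (\<Sum>n<K. if d < 2 ^ n then 1 / 2 ^ n else 0 :: real) = 0"
  proof (induction K)
    case 0
    then show ?case using assms by simp
  next
    case (Suc K)
    consider "d < 2 ^ K" | "\<not> d < 2 ^ K" "d < 2 ^ Suc K" | "\<not> d < 2 ^ Suc K" by blast
    then show ?case
    proof cases
      case 1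
      then have "d < 2 ^ Suc K" by simp
      then show ?thesis using 1 Suc by simp
    next
      case 2
      then have "real d \<le> 2 ^ Suc K" by (metis less_imp_le of_nat_le_iff of_nat_numeral of_nat_power)
      then have "2 / 2 ^ Suc K \<le> 2 / real d" using assms by (intro divide_left_mono) auto
      then show ?thesis using 2 Suc by simp
    next
      case 3
      then have "\<not> d < 2 ^ K" by simp
      then show ?thesis using 3 Suc by simp
    qed
  qed
  then show ?thesis using assms by (auto split: if_splits intro: order_trans[rotated])
qed

text \<open>
  Summing \<open>2 ^ (- n) * (\<Sum>d<2 ^ n. b d)\<close> over \<open>n\<close> weights \<open>b d\<close> by the sum of \<open>2 ^ (- n)\<close> over
  \<open>2 ^ n > d\<close>, which is at most \<open>2 / d\<close> when \<open>d > 0\<close>.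
\<close>

lemma dyadic_averages_not_summable:
  fixes b r :: "nat \<Rightarrow> real"
  assumes b: "\<And>d. 0 \<le> b d" and c: "0 < c" and r: "\<And>n. 0 \<le> r n" "\<not> summable r"
    and le: "\<And>n. c * (2 ^ n * r n) \<le> (\<Sum>d<2 ^ n. b d)"
  shows "\<not> summable (\<lambda>d. b (Suc d) / real (Suc d))"
proof
  assume sm: "summable (\<lambda>d. b (Suc d) / real (Suc d))"
  define s where "s = (\<Sum>d. b (Suc d) / real (Suc d))"
  have "(\<Sum>n<K. r n) \<le> (2 * b 0 + 2 * s) / c" for K
  proof -
    have "c * r n \<le> b 0 * (1 / 2) ^ n + (\<Sum>d<2 ^ K. if Suc d < 2 ^ n then b (Suc d) / 2 ^ n else 0)" if "n < K" for n
    proof -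
      have "(\<Sum>d<2 ^ n. b d) = b 0 + (\<Sum>d | Suc d < 2 ^ n. b (Suc d))"
      proof -
        have "{..<2 ^ n} = insert 0 (Suc ` {d. Suc d < 2 ^ n})"
          by (auto simp: image_iff) (metis not0_implies_Suc)
        moreover have "finite {d. Suc d < 2 ^ n}" by (rule finite_subset[of _ "{..<2 ^ n}"]) auto
        ultimately show ?thesis by (simp add: sum.reindex)
      qed
      also have "(\<Sum>d | Suc d < 2 ^ n. b (Suc d)) = (\<Sum>d<2 ^ K. if Suc d < 2 ^ n then b (Suc d) else 0)"
      proof -
        have "(2::nat) ^ n \<le> 2 ^ K" using that by (intro power_increasing) auto
        then have "{d. Suc d < 2 ^ n} = {d \<in> {..<2 ^ K}. Suc d < 2 ^ n}"
          by (auto simp del: power_increasing_iff)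
        then show ?thesis by (simp add: sum.inter_filter[symmetric])
      qed
      finally have "c * r n * 2 ^ n \<le> b 0 + (\<Sum>d<2 ^ K. if Suc d < 2 ^ n then b (Suc d) else 0)"
        using le[of n] by (simp add: mult_ac)
      then have "c * r n \<le> (b 0 + (\<Sum>d<2 ^ K. if Suc d < 2 ^ n then b (Suc d) else 0)) / 2 ^ n"
        by (simp add: pos_le_divide_eq)
      also have "\<dots> = b 0 * (1 / 2) ^ n + (\<Sum>d<2 ^ K. if Suc d < 2 ^ n then b (Suc d) / 2 ^ n else 0)"
        by (simp add: add_divide_distrib sum_divide_distrib power_one_over if_distrib[of "\<lambda>x. x / 2 ^ n"] cong: if_cong)
      finally show ?thesis .
    qed
    then have "(\<Sum>n<K. c * r n)
        \<le> (\<Sum>n<K. b 0 * (1 / 2) ^ n + (\<Sum>d<2 ^ K. if Suc d < 2 ^ n then b (Suc d) / 2 ^ n else 0))"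
      by (intro sum_mono) auto
    also have "\<dots> = b 0 * (\<Sum>n<K. (1 / 2) ^ n) + (\<Sum>d<2 ^ K. \<Sum>n<K. if Suc d < 2 ^ n then b (Suc d) / 2 ^ n else 0)"
      by (simp add: sum.distrib sum_distrib_left) (rule sum.swap)
    also have "\<dots> \<le> b 0 * 2 + (\<Sum>d<2 ^ K. 2 * (b (Suc d) / real (Suc d)))"
    proof (intro add_mono mult_left_mono sum_mono b)
      have "(\<Sum>n<K. (1 / 2) ^ n) \<le> (\<Sum>n. (1 / 2 :: real) ^ n)"
        by (intro sum_le_suminf summable_geometric) auto
      then show "(\<Sum>n<K. (1 / 2) ^ n) \<le> (2::real)" by (simp add: suminf_geometric)
      fix d
      have "(\<Sum>n<K. if Suc d < 2 ^ n then b (Suc d) / 2 ^ n else 0)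
          = b (Suc d) * (\<Sum>n<K. if Suc d < 2 ^ n then 1 / 2 ^ n else 0)"
        by (simp add: sum_distrib_left if_distrib[of "\<lambda>x. b (Suc d) * x"] cong: if_cong)
      also have "\<dots> \<le> b (Suc d) * (2 / real (Suc d))" by (intro mult_left_mono sum_dyadic_tail_le b) auto
      finally show "(\<Sum>n<K. if Suc d < 2 ^ n then b (Suc d) / 2 ^ n else 0) \<le> 2 * (b (Suc d) / real (Suc d))"
        by (simp add: mult.commute)
    qed
    also have "(\<Sum>d<2 ^ K. 2 * (b (Suc d) / real (Suc d))) \<le> 2 * s"
      unfolding sum_distrib_left[symmetric] s_def using b by (intro mult_left_mono sum_le_suminf sm) auto
    finally have "c * (\<Sum>n<K. r n) \<le> 2 * b 0 + 2 * s" by (simp add: sum_distrib_left)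
    then show ?thesis using c by (simp add: field_simps)
  qed
  then have "summable r" using r(1) by (intro summableI_nonneg_bounded)
  then show False using r(2) by simp
qed

section \<open>Harmonic sums along orbits of the skew product\<close>

lemma skew_product_funpow:
  fixes f :: "real \<Rightarrow> int"
  assumes per: "\<And>x. f (x + 1) = f x" and y: "y \<in> {0..<1}"
  shows "(skew_product f \<alpha> ^^ k) (y, g) = (frac (y + real k * \<alpha>), g + rotation_sum f \<alpha> k y)"
proof (induction k)
  case 0
  then show ?case using y by (simp add: rotation_sum_def frac_eq)
next
  case (Suc k)
  have "frac (frac (y + real k * \<alpha>) + \<alpha>) = frac (y + real (Suc k) * \<alpha>)"
  proof -
    have "y + real (Suc k) * \<alpha> = (frac (y + real k * \<alpha>) + \<alpha>) + of_int \<lfloor>y + real k * \<alpha>\<rfloor> * 1"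
      by (simp add: frac_def algebra_simps)
    then show ?thesis using periodic_int[of frac 1, OF frac_1_eq] by metis
  qed
  moreover have "f (frac (y + real k * \<alpha>)) = f (y + real k * \<alpha>)" by (rule periodic_frac[of f, OF per])
  ultimately show ?case using Suc by (simp add: skew_product_def rotation_sum_def)
qed

lemma space_skew [simp]: "space skew_measure = {0..<1} \<times> UNIV"
  by (simp add: skew_measure_def space_pair_measure)

lemma skew_product_measurable:
  fixes f :: "real \<Rightarrow> int"
  assumes f [measurable]: "f \<in> measurable borel (count_space UNIV)"
  shows "skew_product f \<alpha> \<in> measurable skew_measure skew_measure"
proof -
  have [measurable]: "f \<in> measurable circle_measure (count_space UNIV)" by (intro borel_measurable_circle) simp
  show ?thesis unfolding skew_product_def skew_measure_def by measurable
qed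

lemma weighted_visits_measurable:
  assumes [measurable]: "T \<in> measurable M M" "A \<in> sets M"
  shows "weighted_visits T \<omega> A \<in> borel_measurable M"
proof -
  have [measurable]: "(\<lambda>x. (T ^^ i) x) \<in> measurable M M" for i by (rule measurable_compose_n) simp
  show ?thesis unfolding weighted_visits_def[abs_def] by measurable
qed

text \<open>
  The consecutive weights \<open>1 / (i+1)\<close> and \<open>1 / (i+2)\<close> differ by a factor of at most \<open>2\<close>, so divergence
  is an invariant property of the orbit.
\<close>

lemma weighted_visits_shift_infinite:
  "weighted_visits T (\<lambda>x. 1 / x) A (T x) = \<infinity> \<longleftrightarrow> weighted_visits T (\<lambda>x. 1 / x) A x = \<infinity>"
proof -
  define a :: "nat \<Rightarrow> ennreal" where "a i = indicator A ((T ^^ i) (T (T x)))" for i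
  define Z where "Z = (\<Sum>i. a i * ennreal (1 / real (Suc (Suc i))))"
  have Tx: "weighted_visits T (\<lambda>x. 1 / x) A (T x) = (\<Sum>i. a i * ennreal (1 / real (Suc i)))"
    unfolding weighted_visits_harmonic a_def by (simp add: funpow_swap1)
  have "weighted_visits T (\<lambda>x. 1 / x) A x
      = (\<Sum>i. indicator A ((T ^^ Suc (i + 1)) x) * ennreal (1 / real (Suc (i + 1))))
        + (\<Sum>i<1. indicator A ((T ^^ Suc i) x) * ennreal (1 / real (Suc i)))"
    unfolding weighted_visits_harmonic by (rule suminf_offset) simp
  then have x: "weighted_visits T (\<lambda>x. 1 / x) A x = Z + indicator A (T x)"
    by (simp add: Z_def a_def funpow_swap1)
  have "Z \<le> (\<Sum>i. a i * ennreal (1 / real (Suc i)))"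
    unfolding Z_def by (intro suminf_le mult_left_mono ennreal_leI divide_left_mono) auto
  moreover have "(\<Sum>i. a i * ennreal (1 / real (Suc i))) \<le> (\<Sum>i. 2 * (a i * ennreal (1 / real (Suc (Suc i)))))"
  proof (rule suminf_le)
    fix i
    have "ennreal (1 / real (Suc i)) \<le> ennreal (2 * (1 / real (Suc (Suc i))))"
      by (intro ennreal_leI) (simp add: field_simps)
    also have "\<dots> = 2 * ennreal (1 / real (Suc (Suc i)))" by (subst ennreal_mult) auto
    finally have "a i * ennreal (1 / real (Suc i)) \<le> a i * (2 * ennreal (1 / real (Suc (Suc i))))"
      by (rule mult_left_mono) simp
    then show "a i * ennreal (1 / real (Suc i)) \<le> 2 * (a i * ennreal (1 / real (Suc (Suc i))))"
      by (simp only: mult.left_commute)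
  qed auto
  moreover have "(\<Sum>i. 2 * (a i * ennreal (1 / real (Suc (Suc i))))) = 2 * Z"
    unfolding Z_def by (rule ennreal_suminf_cmult)
  ultimately have Z: "Z \<le> weighted_visits T (\<lambda>x. 1 / x) A (T x)" "weighted_visits T (\<lambda>x. 1 / x) A (T x) \<le> 2 * Z"
    by (simp_all add: Tx)
  have "weighted_visits T (\<lambda>x. 1 / x) A (T x) = \<infinity> \<longleftrightarrow> Z = \<infinity>"
  proof
    assume "weighted_visits T (\<lambda>x. 1 / x) A (T x) = \<infinity>"
    then have "2 * Z = \<infinity>" using Z(2) by (simp add: top_unique)
    then show "Z = \<infinity>" by (simp add: ennreal_mult_eq_top_iff)
  next
    assume "Z = \<infinity>"
    then show "weighted_visits T (\<lambda>x. 1 / x) A (T x) = \<infinity>" using Z(1) by (simp add: top_unique)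
  qed
  moreover have "Z + indicator A (T x) = \<infinity> \<longleftrightarrow> Z = \<infinity>" by (auto simp: indicator_def)
  ultimately show ?thesis unfolding x by simp
qed

text \<open>
  Every return of \<open>(y, v)\<close> to \<open>E \<times> {v}\<close> is a visit to \<open>A\<close>. Integrating the bound \<open>K\<close> for the harmonic sum
  of the visits over \<open>E\<close> bounds the harmonic sum of the return measures.
\<close>

lemma return_measure_sum_le:
  fixes f :: "real \<Rightarrow> int"
  assumes per: "\<And>x. f (x + 1) = f x" and f [measurable]: "f \<in> measurable borel (count_space UNIV)"
    and E: "E \<in> sets circle_measure" and EA: "E \<times> {v} \<subseteq> A"
    and K: "\<And>y. y \<in> E \<Longrightarrow> weighted_visits (skew_product f \<alpha>) (\<lambda>x. 1 / x) A (y, v) \<le> ennreal K" "0 \<le> K"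
  shows "(\<Sum>i<N. return_measure f \<alpha> E (Suc i) / real (Suc i)) \<le> K"
proof -
  have [measurable]: "E \<in> sets borel" and E01: "E \<subseteq> {0..<1}" using E by (auto simp: sets_circle)
  define F where "F d = {y \<in> E. frac (y + real d * \<alpha>) \<in> E \<and> rotation_sum f \<alpha> d y = 0}" for d
  have F: "F d \<in> sets circle_measure" for d
  proof -
    have "F d = E \<inter> {y. frac (y + real d * \<alpha>) \<in> E \<and> rotation_sum f \<alpha> d y = 0}" by (auto simp: F_def)
    also have "\<dots> \<in> sets borel" by measurable
    finally show ?thesis using E01 by (auto simp: sets_circle F_def)
  qed
  have F01: "F d \<inter> {0..<1} = F d" for d using E01 by (auto simp: F_def)
  have le: "(\<Sum>i<N. 1 / real (Suc i) * indicator (F (Suc i)) y) \<le> K * indicator E y" for y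
  proof (cases "y \<in> E")
    case True
    then have y: "y \<in> {0..<1}" using E01 by auto
    have "ennreal (\<Sum>i<N. 1 / real (Suc i) * indicator (F (Suc i)) y)
        = (\<Sum>i<N. ennreal (1 / real (Suc i) * indicator (F (Suc i)) y))"
      by (rule sum_ennreal[symmetric]) simp
    also have "\<dots> \<le> (\<Sum>i<N. indicator A ((skew_product f \<alpha> ^^ Suc i) (y, v)) * ennreal (1 / real (Suc i)))"
    proof (rule sum_mono)
      fix i
      have "(skew_product f \<alpha> ^^ Suc i) (y, v) \<in> A" if "y \<in> F (Suc i)"
        using that EA unfolding skew_product_funpow[of f, OF per y]
        by (auto simp: F_def simp del: of_nat_Suc)
      then show "ennreal (1 / real (Suc i) * indicator (F (Suc i)) y)
          \<le> indicator A ((skew_product f \<alpha> ^^ Suc i) (y, v)) * ennreal (1 / real (Suc i))"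
        by (cases "y \<in> F (Suc i)") (simp_all del: of_nat_Suc funpow.simps)
    qed
    also have "\<dots> \<le> weighted_visits (skew_product f \<alpha>) (\<lambda>x. 1 / x) A (y, v)"
      unfolding weighted_visits_harmonic by (intro sum_le_suminf) auto
    also have "\<dots> \<le> ennreal K" using K True by simp
    finally show ?thesis using True K by (simp add: ennreal_le_iff)
  next
    case False
    then show ?thesis by (simp add: F_def)
  qed
  have int: "integrable circle_measure (indicator S :: real \<Rightarrow> real)" if "S \<in> sets circle_measure" for S
    using that by (simp add: circle.emeasure_eq_measure)
  have "(\<Sum>i<N. return_measure f \<alpha> E (Suc i) / real (Suc i))
      = (\<integral>y. (\<Sum>i<N. 1 / real (Suc i) * indicator (F (Suc i)) y) \<partial>circle_measure)"
    by (subst Bochner_Integration.integral_sum, intro integrable_mult_right int F)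
      (simp add: F01 return_measure_def F_def[symmetric] del: of_nat_Suc)
  also have "\<dots> \<le> (\<integral>y. K * indicator E y \<partial>circle_measure)"
    by (intro integral_mono le Bochner_Integration.integrable_sum integrable_mult_right int E F)
  also have "\<dots> = K * measure circle_measure E" using E E01 by (simp add: Int_absorb2)
  also have "\<dots> \<le> K * 1" using K circle.bounded_measure[of E] by (intro mult_left_mono) auto
  finally show ?thesis by simp
qed

text \<open>
  Otherwise the harmonic sum would be bounded by some \<open>K\<close> on a subset of \<open>A\<close> of positive measure, which
  may be taken inside one level; the expected harmonic sum of the returns of that subset to itself would
  then be finite.
\<close>

lemma infinite_visits_from_set:
  fixes f :: "real \<Rightarrow> int"
  assumes per: "\<And>x. f (x + 1) = f x" and f [measurable]: "f \<in> measurable borel (count_space UNIV)"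
    and ns: "\<And>E. E \<in> sets circle_measure \<Longrightarrow> 0 < measure circle_measure E \<Longrightarrow>
          \<not> summable (\<lambda>d. return_measure f \<alpha> E (Suc d) / real (Suc d))"
    and A [measurable]: "A \<in> sets skew_measure"
  shows "AE x in skew_measure. x \<in> A \<longrightarrow> weighted_visits (skew_product f \<alpha>) (\<lambda>x. 1 / x) A x = \<infinity>"
proof -
  let ?\<zeta> = "weighted_visits (skew_product f \<alpha>) (\<lambda>x. 1 / x) A"
  have [measurable]: "?\<zeta> \<in> borel_measurable skew_measure"
    using skew_product_measurable[OF f] A by (rule weighted_visits_measurable)
  define E where "E K v = {y. (y, v) \<in> A \<and> ?\<zeta> (y, v) \<le> ennreal (real K)}" for K :: nat and v
  have "E K v \<times> {v} \<in> null_sets skew_measure" for K v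
  proof -
    have "E K v = (\<lambda>y. (y, v)) -` {x \<in> space skew_measure. x \<in> A \<and> ?\<zeta> x \<le> ennreal (real K)}"
      using sets.sets_into_space[OF A] by (auto simp: E_def)
    also have "\<dots> \<in> sets circle_measure"
    proof (rule sets_Pair2)
      show "{x \<in> space skew_measure. x \<in> A \<and> ?\<zeta> x \<le> ennreal (real K)} \<in> sets (circle_measure \<Otimes>\<^sub>M count_space UNIV)"
        unfolding skew_measure_def[symmetric] by measurable
    qed
    finally have E: "E K v \<in> sets circle_measure" .
    have "measure circle_measure (E K v) = 0"
    proof (rule ccontr)
      assume "measure circle_measure (E K v) \<noteq> 0"
      then have "\<not> summable (\<lambda>d. return_measure f \<alpha> (E K v) (Suc d) / real (Suc d))"
        using ns[OF E] by (simp add: zero_less_measure_iff)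
      moreover have "summable (\<lambda>d. return_measure f \<alpha> (E K v) (Suc d) / real (Suc d))"
      proof (rule summableI_nonneg_bounded)
        show "0 \<le> return_measure f \<alpha> (E K v) (Suc d) / real (Suc d)" for d by (simp add: return_measure_def)
        show "(\<Sum>i<n. return_measure f \<alpha> (E K v) (Suc i) / real (Suc i)) \<le> real K" for n
          by (rule return_measure_sum_le[OF per f E, of v A]) (auto simp: E_def)
      qed
      ultimately show False by simp
    qed
    then have "emeasure circle_measure (E K v) = 0" by (simp add: circle.emeasure_eq_measure)
    moreover have "emeasure skew_measure (E K v \<times> {v}) = emeasure circle_measure (E K v) * emeasure (count_space UNIV) {v}"
      unfolding skew_measure_def using E
      by (intro sigma_finite_measure.emeasure_pair_measure_Times sigma_finite_measure_count_space) auto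
    moreover have "E K v \<times> {v} \<in> sets skew_measure" unfolding skew_measure_def using E by (intro pair_measureI) auto
    ultimately show ?thesis by (auto intro!: null_setsI)
  qed
  then have "AE x in skew_measure. \<forall>K v. x \<notin> E K v \<times> {v}"
    by (simp only: AE_all_countable) (auto intro: AE_not_in)
  then show ?thesis
  proof (rule AE_mp, intro AE_I2 impI)
    fix x assume x: "\<forall>K v. x \<notin> E K v \<times> {v}" "x \<in> A"
    show "?\<zeta> x = \<infinity>"
    proof (rule ccontr)
      assume "?\<zeta> x \<noteq> \<infinity>"
      then obtain K where "?\<zeta> x < of_nat K" using ennreal_Ex_less_of_nat[of "?\<zeta> x"] by (auto simp: less_top)
      then have "x \<in> E K (snd x) \<times> {snd x}"
        using x(2) by (cases x) (auto simp: E_def ennreal_of_nat_eq_real_of_nat less_imp_le)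
      then show False using x(1) by metis
    qed
  qed
qed

lemma omega_recurrent_if_returns_not_summable:
  fixes f :: "real \<Rightarrow> int"
  assumes per: "\<And>x. f (x + 1) = f x" and f [measurable]: "f \<in> measurable borel (count_space UNIV)"
    and ns: "\<And>E. E \<in> sets circle_measure \<Longrightarrow> 0 < measure circle_measure E \<Longrightarrow>
          \<not> summable (\<lambda>d. return_measure f \<alpha> E (Suc d) / real (Suc d))"
    and erg: "ergodic skew_measure (skew_product f \<alpha>)"
  shows "omega_recurrent skew_measure (skew_product f \<alpha>) (\<lambda>x. 1 / x)"
  unfolding omega_recurrent_def
proof (intro ballI impI)
  fix A assume A [measurable]: "A \<in> sets skew_measure" and pos: "0 < emeasure skew_measure A \<and> emeasure skew_measure A < \<infinity>"
  let ?T = "skew_product f \<alpha>"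
  let ?\<zeta> = "weighted_visits ?T (\<lambda>x. 1 / x) A"
  have T: "?T \<in> measurable skew_measure skew_measure" by (rule skew_product_measurable) (rule f)
  have [measurable]: "?\<zeta> \<in> borel_measurable skew_measure" using T A by (rule weighted_visits_measurable)
  define U where "U = {x \<in> space skew_measure. ?\<zeta> x = \<infinity>}"
  have U [measurable]: "U \<in> sets skew_measure" unfolding U_def by measurable
  have "?T -` U \<inter> space skew_measure = U"
    unfolding U_def using measurable_space[OF T] by (auto simp del: space_skew simp: weighted_visits_shift_infinite[unfolded infinity_ennreal_def])
  then have "emeasure skew_measure U = 0 \<or> emeasure skew_measure (space skew_measure - U) = 0"
    using erg U unfolding ergodic_def by blast
  moreover have "emeasure skew_measure U \<noteq> 0"
  proof
    assume "emeasure skew_measure U = 0"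
    then have "AE x in skew_measure. x \<notin> U" by (intro AE_not_in) (auto intro: null_setsI)
    moreover have "AE x in skew_measure. x \<in> A \<longrightarrow> ?\<zeta> x = \<infinity>"
      using per f ns A by (rule infinite_visits_from_set)
    ultimately have "AE x in skew_measure. x \<notin> A" using AE_space by eventually_elim (auto simp: U_def)
    then have "emeasure skew_measure A = 0"
      using A by (simp add: AE_iff_null_sets[symmetric] null_setsD1)
    then show False using pos by simp
  qed
  ultimately have "space skew_measure - U \<in> null_sets skew_measure"
    using sets.compl_sets[OF U] by (intro null_setsI) auto
  then have "AE x in skew_measure. x \<notin> space skew_measure - U" by (rule AE_not_in)
  then show "AE x in skew_measure. ?\<zeta> x = \<infinity>" using AE_space by eventually_elim (auto simp: U_def)
qed

text \<open>
  The bounds for the Birkhoff sums up to time \<open>2 ^ n\<close> limit the number of levels visited, hence bound the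
  return measures from below on average, and the resulting series diverges for generic \<open>\<alpha>\<close>.
\<close>

lemma returns_not_summable:
  fixes f :: "real \<Rightarrow> int"
  assumes per: "\<And>x. f (x + 1) = f x"
    and var: "variation_bound {0..1} (\<lambda>x. real_of_int (f x)) B"
    and zero: "(\<integral>y. real_of_int (f y) \<partial>circle_measure) = 0"
    and f [measurable]: "f \<in> measurable borel (count_space UNIV)"
    and \<alpha>: "\<forall>Q. (\<forall>j. 0 < Q j \<and> Q j \<le> 2 ^ j \<and> (\<exists>p::int. \<bar>real (Q j) * \<alpha> - of_int p\<bar> \<le> 1 / 2 ^ j))
      \<longrightarrow> \<not> summable (\<lambda>n. 1 / (1 + (\<Sum>j<n. 2 ^ j / real (Q j))))"
    and E: "E \<in> sets circle_measure" and pos: "0 < measure circle_measure E"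
  shows "\<not> summable (\<lambda>d. return_measure f \<alpha> E (Suc d) / real (Suc d))"
proof -
  obtain Q :: "nat \<Rightarrow> nat" where Q: "\<And>j. 0 < Q j" "\<And>j. Q j \<le> 2 ^ j"
    and close: "\<And>j. \<exists>p. coprime p (int (Q j)) \<and> \<bar>real (Q j) * \<alpha> - of_int p\<bar> \<le> 1 / 2 ^ j"
    using dyadic_denominators_exist[of \<alpha>] by blast
  define X where "X n = (\<Sum>j<n. 2 ^ j / real (Q j))" for n
  have X0: "0 \<le> X n" for n unfolding X_def by (intro sum_nonneg) auto
  define c where "c = 8 * B + 1"
  have B0: "0 \<le> B" using var[rule_format, of 0 "\<lambda>_. 0"] by (simp add: mono_on_def)
  have dk: "\<bar>rotation_sum (\<lambda>x. real_of_int (f x)) \<alpha> (Q j) y\<bar> \<le> 2 * B" for j y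
  proof -
    obtain p where p: "coprime p (int (Q j))" "\<bar>real (Q j) * \<alpha> - of_int p\<bar> \<le> 1 / 2 ^ j" using close by blast
    have "real (Q j) \<le> real (2 ^ j)" using Q(2) by (rule of_nat_mono)
    then have "1 / 2 ^ j \<le> 1 / real (Q j)" using Q(1)[of j] by (intro divide_left_mono) auto
    then have "\<bar>real (Q j) * \<alpha> - of_int p\<bar> \<le> 1 / real (Q j)" using p(2) by linarith
    then show ?thesis by (intro denjoy_koksma[OF var _ zero Q(1) p(1)]) (simp_all add: per)
  qed
  have bound: "\<bar>real_of_int (rotation_sum f \<alpha> k y)\<bar> \<le> 4 * B * X n" if "k < 2 ^ n" for k y n
    using rotation_sum_dyadic_bound[of Q "\<lambda>x. real_of_int (f x)", OF Q dk that, of y]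
    by (simp add: rotation_sum_def X_def)
  show ?thesis
  proof (rule dyadic_averages_not_summable[where c = "(measure circle_measure E)\<^sup>2 / 2 / c" 
        and b = "return_measure f \<alpha> E" and r = "\<lambda>n. 1 / (1 + X n)"])
    show "0 \<le> return_measure f \<alpha> E d" for d by (simp add: return_measure_def)
    show "0 < (measure circle_measure E)\<^sup>2 / 2 / c" using pos B0 by (simp add: c_def)
    show "0 \<le> 1 / (1 + X n)" for n using X0[of n] by simp
    show "\<not> summable (\<lambda>n. 1 / (1 + X n))" unfolding X_def using \<alpha> Q close by blast
    show "(measure circle_measure E)\<^sup>2 / 2 / c * (2 ^ n * (1 / (1 + X n))) \<le> (\<Sum>d<2 ^ n. return_measure f \<alpha> E d)" for n
    proof -
      have R0: "0 \<le> 4 * B * X n" using B0 X0 by simp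
      have "(measure circle_measure E)\<^sup>2 / 2 * (real (2 ^ n) / (2 * (4 * B * X n) + 1)) \<le> (\<Sum>d<2 ^ n. return_measure f \<alpha> E d)"
        by (rule return_measure_lower_bound[OF per f E _ R0 bound]) auto
      moreover have "(measure circle_measure E)\<^sup>2 / 2 * (real (2 ^ n) / (c * (1 + X n)))
          \<le> (measure circle_measure E)\<^sup>2 / 2 * (real (2 ^ n) / (2 * (4 * B * X n) + 1))"
      proof (intro mult_left_mono divide_left_mono)
        show "2 * (4 * B * X n) + 1 \<le> c * (1 + X n)" using B0 X0[of n] by (simp add: c_def algebra_simps)
        show "0 < (c * (1 + X n)) * (2 * (4 * B * X n) + 1)"
          using B0 X0[of n] R0 by (intro mult_pos_pos add_nonneg_pos add_pos_nonneg) (auto simp: c_def)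
      qed auto
      ultimately show ?thesis by (simp add: mult.assoc)
    qed
  qed
qed

lemma AE_circle_imp_AE_lebesgue_on:
  assumes "AE \<alpha> in circle_measure. P \<alpha>"
  shows "AE \<alpha> in lebesgue_on {0<..<1}. P \<alpha>"
proof -
  have "AE \<alpha> in lborel. \<alpha> \<in> {0..<1::real} \<longrightarrow> P \<alpha>"
    using assms unfolding circle_measure_def by (subst (asm) AE_restrict_space_iff) auto
  then have "AE \<alpha> in lebesgue. \<alpha> \<in> {0..<1::real} \<longrightarrow> P \<alpha>" by (rule AE_completion)
  then have "AE \<alpha> in lebesgue. \<alpha> \<in> {0<..<1::real} \<longrightarrow> P \<alpha>" by (rule eventually_mono) auto
  then show ?thesis by (subst AE_restrict_space_iff) auto
qed

lemma integral_circle_eq_set_integral: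
  fixes g :: "real \<Rightarrow> real"
  assumes [measurable]: "g \<in> borel_measurable borel"
  shows "(\<integral>y. g y \<partial>circle_measure) = (LBINT y:{0..1}. g y)"
proof -
  have "(\<integral>y. g y \<partial>circle_measure) = (LBINT y:{0..<1}. g y)"
    unfolding circle_measure_def set_lebesgue_integral_def by (subst integral_restrict_space) auto
  also have "\<dots> = (LBINT y:{0..1}. g y)"
    unfolding set_lebesgue_integral_def
  proof (rule integral_cong_AE)
    show "AE y in lborel. indicator {0..<1} y *\<^sub>R g y = indicator {0..1} y *\<^sub>R g y"
      using AE_lborel_singleton[of 1] by eventually_elim (auto simp: indicator_def)
  qed measurable
  finally show ?thesis .
qed

theorem theorem3p2:
  fixes f :: "real \<Rightarrow> int"
  assumes periodic: "\<And>x. f (x + 1) = f x"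
    and bounded_variation: "bounded_variation_on {0..1} (\<lambda>x. real_of_int (f x))"
    and mean_zero: "(LBINT t:{0..1}. real_of_int (f t)) = 0"
    and conservative_ergodic:
      "AE \<alpha> in lebesgue_on {0<..<1}. \<alpha> \<notin> \<rat> \<longrightarrow>
         conservative skew_measure (skew_product f \<alpha>) \<and> ergodic skew_measure (skew_product f \<alpha>)"
  shows "AE \<alpha> in lebesgue_on {0<..<1}. \<alpha> \<notin> \<rat> \<longrightarrow>
           omega_recurrent skew_measure (skew_product f \<alpha>) (\<lambda>x. 1 / x)"
proof -
  obtain B where var: "variation_bound {0..1} (\<lambda>x. real_of_int (f x)) B"
    using bounded_variation unfolding bounded_variation_on_def by blast
  have fr: "(\<lambda>x. real_of_int (f x)) \<in> borel_measurable borel"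
    by (rule bounded_variation_borel[OF var]) (simp add: periodic)
  have f: "f \<in> measurable borel (count_space UNIV)"
  proof (subst measurable_count_space_eq2_countable, safe)
    fix v
    have "f -` {v} \<inter> space borel = (\<lambda>x. real_of_int (f x)) -` {real_of_int v} \<inter> space borel" by auto
    also have "\<dots> \<in> sets borel" using fr by (rule measurable_sets) simp
    finally show "f -` {v} \<inter> space borel \<in> sets borel" .
  qed auto
  have zero: "(\<integral>y. real_of_int (f y) \<partial>circle_measure) = 0"
    using integral_circle_eq_set_integral[OF fr] mean_zero by simp
  from conservative_ergodic AE_circle_imp_AE_lebesgue_on[OF AE_dyadic_denominators]
  show ?thesis
  proof (eventually_elim, intro impI)
    fix \<alpha> assume irr: "\<alpha> \<notin> \<rat>" and ce: "\<alpha> \<notin> \<rat> \<longrightarrow> conservative skew_measure (skew_product f \<alpha>) \<and> ergodic skew_measure (skew_product f \<alpha>)"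
      and \<alpha>: "\<forall>Q. (\<forall>j. 0 < Q j \<and> Q j \<le> 2 ^ j \<and> (\<exists>p::int. \<bar>real (Q j) * \<alpha> - of_int p\<bar> \<le> 1 / 2 ^ j))
      \<longrightarrow> \<not> summable (\<lambda>n. 1 / (1 + (\<Sum>j<n. 2 ^ j / real (Q j))))"
    show "omega_recurrent skew_measure (skew_product f \<alpha>) (\<lambda>x. 1 / x)"
    proof (rule omega_recurrent_if_returns_not_summable[OF periodic f])
      show "ergodic skew_measure (skew_product f \<alpha>)" using ce irr by simp
    qed (rule returns_not_summable[OF periodic var zero f \<alpha>])
  qed
qed

end
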